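(* Let $G=GL(m|n)$ over a field $K$ of characteristic $p>2$, let $q=p^r$, let $0\le a\le q-1$, let $1\le i\ne j\le m+n$ and $1\le t<q$ (with $t=1$ if $e_{ij}$ is odd). Then the following relations hold in $Dist(G)$: (1) $h^{(q)}_a(e_s)\,e_{ij}^{(t)}=e_{ij}^{(t)}\,h^{(q)}_a(e_s)$ if $s\ne i,j$; (2) $h^{(q)}_a(e_i)\,e_{ij}^{(t)}=e_{ij}^{(t)}\,h^{(q)}_{\overline{a-t}}(e_i)$; (3) $h^{(q)}_a(e_j)\,e_{ij}^{(t)}=e_{ij}^{(t)}\,h^{(q)}_{\overline{a+t}}(e_j)$.
   Context: $K$ is a field of characteristic $p>2$, $G=GL(m|n)$. Its distribution superalgebra is $Dist(G)=Dist(G)_{\mathbb Z}\otimes_{\mathbb Z}K$, where $Dist(G)_{\mathbb Z}$ is the subsuperring of the universal enveloping superalgebra of the general linear Lie superalgebra $\mathfrak{gl}(m|n)$ (in characteristic $0$, with matrix units $e_{ij}$, $e_{ij}$ even iff $i,j\le m$ or $i,j>m$) generated by the divided powers $e_{ij}^{(t)}=e_{ij}^t/t!$ ($i\ne j$, $t\ge1$, and $t=1$ only when $e_{ij}$ is odd) and $\binom{e_{ii}}{s}=\frac{e_{ii}(e_{ii}-1)\cdots(e_{ii}-s+1)}{s!}$ ($s\ge0$). Write $e_i=e_{ii}$. For $q=p^r$ and $0\le t\le q-1$, $h^{(q)}_t(x)=\sum_{t\le k\le q-1}(-1)^{k-t}\binom kt\binom xk$. For an integer $u$, $\overline u$ is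 the representative of $u$ modulo $q$ with $0\le\overline u<q$. *)

theory Defs
  imports
    "HOL-Library.Poly_Mapping"
    "HOL-Algebra.Generated_Rings"
    "HOL-Algebra.Algebraic_Closure_Type"
    "Jordan_Normal_Form.Matrix"
begin

section \<open>Monoid rings\<close>

definition monoid_ring :: "('g, 'c) monoid_scheme \<Rightarrow> ('g \<Rightarrow>\<^sub>0 'r::comm_ring_1) ring" where
  "monoid_ring G =
     \<lparr>carrier = {f. Poly_Mapping.keys f \<subseteq> carrier G},
      monoid.mult = (\<lambda>f g. \<Sum>x\<in>Poly_Mapping.keys f. \<Sum>y\<in>Poly_Mapping.keys g.
                Poly_Mapping.single (x \<otimes>\<^bsub>G\<^esub> y) (Poly_Mapping.lookup f x * Poly_Mapping.lookup g y)),
      one = Poly_Mapping.single \<one>\<^bsub>G\<^esub> 1,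
      ring.zero = 0,
      add = (+)\<rparr>"

lemma monoid_ring_mult_superset:
  assumes "finite A" "Poly_Mapping.keys f \<subseteq> A" "finite B" "Poly_Mapping.keys g \<subseteq> B"
  shows "f \<otimes>\<^bsub>monoid_ring G\<^esub> g = (\<Sum>x\<in>A. \<Sum>y\<in>B.
    Poly_Mapping.single (x \<otimes>\<^bsub>G\<^esub> y) (Poly_Mapping.lookup f x * Poly_Mapping.lookup g y))"
proof -
  have "(\<Sum>y\<in>Poly_Mapping.keys g.
      Poly_Mapping.single (x \<otimes>\<^bsub>G\<^esub> y) (Poly_Mapping.lookup f x * Poly_Mapping.lookup g y))
    = (\<Sum>y\<in>B. Poly_Mapping.single (x \<otimes>\<^bsub>G\<^esub> y) (Poly_Mapping.lookup f x * Poly_Mapping.lookup g y))" for x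
    by (rule sum.mono_neutral_left) (use assms in \<open>auto simp: in_keys_iff\<close>)
  moreover have "(\<Sum>x\<in>Poly_Mapping.keys f. \<Sum>y\<in>B.
      Poly_Mapping.single (x \<otimes>\<^bsub>G\<^esub> y) (Poly_Mapping.lookup f x * Poly_Mapping.lookup g y))
    = (\<Sum>x\<in>A. \<Sum>y\<in>B.
      Poly_Mapping.single (x \<otimes>\<^bsub>G\<^esub> y) (Poly_Mapping.lookup f x * Poly_Mapping.lookup g y))"
    by (rule sum.mono_neutral_left) (use assms in \<open>auto simp: in_keys_iff\<close>)
  ultimately show ?thesis by (simp add: monoid_ring_def)
qed

lemma monoid_ring_mult_single:
  "Poly_Mapping.single x a \<otimes>\<^bsub>monoid_ring G\<^esub> Poly_Mapping.single y b
    = Poly_Mapping.single (x \<otimes>\<^bsub>G\<^esub> y) (a * b)"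
  by (subst monoid_ring_mult_superset[where A="{x}" and B="{y}"]) auto

lemma monoid_ring_distrib:
  "(f + g) \<otimes>\<^bsub>monoid_ring G\<^esub> h = f \<otimes>\<^bsub>monoid_ring G\<^esub> h + g \<otimes>\<^bsub>monoid_ring G\<^esub> h" (is ?l)
  "h \<otimes>\<^bsub>monoid_ring G\<^esub> (f + g) = h \<otimes>\<^bsub>monoid_ring G\<^esub> f + h \<otimes>\<^bsub>monoid_ring G\<^esub> g" (is ?r)
proof -
  let ?A = "Poly_Mapping.keys f \<union> Poly_Mapping.keys g" and ?B = "Poly_Mapping.keys h"
  have k: "Poly_Mapping.keys (f + g) \<subseteq> ?A" by (rule Poly_Mapping.keys_add)
  have l: "u \<otimes>\<^bsub>monoid_ring G\<^esub> h = (\<Sum>x\<in>?A. \<Sum>y\<in>?B.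
      Poly_Mapping.single (x \<otimes>\<^bsub>G\<^esub> y) (Poly_Mapping.lookup u x * Poly_Mapping.lookup h y))"
    if "Poly_Mapping.keys u \<subseteq> ?A" for u
    by (rule monoid_ring_mult_superset) (use that in auto)
  have r: "h \<otimes>\<^bsub>monoid_ring G\<^esub> u = (\<Sum>x\<in>?B. \<Sum>y\<in>?A.
      Poly_Mapping.single (x \<otimes>\<^bsub>G\<^esub> y) (Poly_Mapping.lookup h x * Poly_Mapping.lookup u y))"
    if "Poly_Mapping.keys u \<subseteq> ?A" for u
    by (rule monoid_ring_mult_superset) (use that in auto)
  show ?l ?r
    by (simp_all add: l r k lookup_add ring_distribs single_add sum.distrib)
qed

lemma monoid_ring_mult_zero:
  "0 \<otimes>\<^bsub>monoid_ring G\<^esub> h = 0" "h \<otimes>\<^bsub>monoid_ring G\<^esub> 0 = 0"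
  by (simp_all add: monoid_ring_def)

lemma monoid_ring_mult_sum:
  "sum f A \<otimes>\<^bsub>monoid_ring G\<^esub> h = (\<Sum>x\<in>A. f x \<otimes>\<^bsub>monoid_ring G\<^esub> h)"
  "h \<otimes>\<^bsub>monoid_ring G\<^esub> sum f A = (\<Sum>x\<in>A. h \<otimes>\<^bsub>monoid_ring G\<^esub> f x)"
  by (induction A rule: infinite_finite_induct)
     (simp_all add: monoid_ring_distrib monoid_ring_mult_zero)

lemma poly_mapping_eq_sum_single:
  "f = (\<Sum>x\<in>Poly_Mapping.keys f. Poly_Mapping.single x (Poly_Mapping.lookup f x))"
  by (rule poly_mapping_eqI)
     (auto simp: lookup_sum lookup_single when_def in_keys_iff)

lemma ring_monoid_ring:
  assumes "monoid G"
  shows "ring (monoid_ring G :: ('g \<Rightarrow>\<^sub>0 'r::comm_ring_1) ring)" (is "ring ?R")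
proof -
  interpret monoid G by fact
  have closed: "f \<otimes>\<^bsub>?R\<^esub> g \<in> carrier ?R" if "f \<in> carrier ?R" "g \<in> carrier ?R" for f g
  proof -
    have k: "Poly_Mapping.keys f \<subseteq> carrier G" "Poly_Mapping.keys g \<subseteq> carrier G"
      using that by (auto simp: monoid_ring_def)
    have "Poly_Mapping.keys (f \<otimes>\<^bsub>?R\<^esub> g) \<subseteq> carrier G"
    proof
      fix z assume z: "z \<in> Poly_Mapping.keys (f \<otimes>\<^bsub>?R\<^esub> g)"
      show "z \<in> carrier G"
      proof (rule ccontr)
        assume "z \<notin> carrier G"
        then have "x \<otimes>\<^bsub>G\<^esub> y \<noteq> z" if "x \<in> Poly_Mapping.keys f" "y \<in> Poly_Mapping.keys g" for x y
          using that k by auto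
        then have "Poly_Mapping.lookup (f \<otimes>\<^bsub>?R\<^esub> g) z = 0"
          by (simp add: monoid_ring_def lookup_sum lookup_single when_def)
        then show False using z by (simp add: in_keys_iff)
      qed
    qed
    then show ?thesis by (simp add: monoid_ring_def)
  qed
  have assoc: "(f \<otimes>\<^bsub>?R\<^esub> g) \<otimes>\<^bsub>?R\<^esub> h = f \<otimes>\<^bsub>?R\<^esub> (g \<otimes>\<^bsub>?R\<^esub> h)"
    if "f \<in> carrier ?R" "g \<in> carrier ?R" "h \<in> carrier ?R" for f g h
  proof -
    have k: "Poly_Mapping.keys f \<subseteq> carrier G" "Poly_Mapping.keys g \<subseteq> carrier G"
      "Poly_Mapping.keys h \<subseteq> carrier G"
      using that by (auto simp: monoid_ring_def)
    let ?s = "\<lambda>f x. Poly_Mapping.single x (Poly_Mapping.lookup f x)"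
    have "(sum (?s f) (Poly_Mapping.keys f) \<otimes>\<^bsub>?R\<^esub> sum (?s g) (Poly_Mapping.keys g))
            \<otimes>\<^bsub>?R\<^esub> sum (?s h) (Poly_Mapping.keys h)
        = sum (?s f) (Poly_Mapping.keys f) \<otimes>\<^bsub>?R\<^esub>
            (sum (?s g) (Poly_Mapping.keys g) \<otimes>\<^bsub>?R\<^esub> sum (?s h) (Poly_Mapping.keys h))"
      unfolding monoid_ring_mult_sum monoid_ring_mult_single
      by (subst sum.swap, rule sum.cong[OF refl], intro sum.cong refl sum.swap [THEN trans])
         (use k in \<open>auto simp: m_assoc mult.assoc subset_iff intro!: sum.cong\<close>)
    then show ?thesis by (simp add: poly_mapping_eq_sum_single[symmetric])
  qed
  have unit: "\<one>\<^bsub>?R\<^esub> \<otimes>\<^bsub>?R\<^esub> f = f" "f \<otimes>\<^bsub>?R\<^esub> \<one>\<^bsub>?R\<^esub> = f" if "f \<in> carrier ?R" for f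
  proof -
    have k: "Poly_Mapping.keys f \<subseteq> carrier G" using that by (auto simp: monoid_ring_def)
    let ?s = "\<lambda>x. Poly_Mapping.single x (Poly_Mapping.lookup f x)"
    have one: "\<one>\<^bsub>?R\<^esub> = Poly_Mapping.single \<one>\<^bsub>G\<^esub> 1" by (simp add: monoid_ring_def)
    have "\<one>\<^bsub>?R\<^esub> \<otimes>\<^bsub>?R\<^esub> sum ?s (Poly_Mapping.keys f) = sum ?s (Poly_Mapping.keys f)"
      "sum ?s (Poly_Mapping.keys f) \<otimes>\<^bsub>?R\<^esub> \<one>\<^bsub>?R\<^esub> = sum ?s (Poly_Mapping.keys f)"
      unfolding one monoid_ring_mult_sum monoid_ring_mult_single
      by (rule sum.cong[OF refl], use k in auto)+
    then show "\<one>\<^bsub>?R\<^esub> \<otimes>\<^bsub>?R\<^esub> f = f" "f \<otimes>\<^bsub>?R\<^esub> \<one>\<^bsub>?R\<^esub> = f"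
      by (simp_all add: poly_mapping_eq_sum_single[symmetric])
  qed
  show ?thesis
  proof (rule ringI)
    show "abelian_group ?R"
    proof (rule abelian_groupI)
      fix x y assume "x \<in> carrier ?R" "y \<in> carrier ?R"
      then show "x \<oplus>\<^bsub>?R\<^esub> y \<in> carrier ?R"
        using Poly_Mapping.keys_add[of x y] by (auto simp: monoid_ring_def)
    next
      fix x assume "x \<in> carrier ?R"
      then have "-x \<in> carrier ?R" "-x \<oplus>\<^bsub>?R\<^esub> x = \<zero>\<^bsub>?R\<^esub>"
        by (simp_all add: monoid_ring_def)
      then show "\<exists>y\<in>carrier ?R. y \<oplus>\<^bsub>?R\<^esub> x = \<zero>\<^bsub>?R\<^esub>" by blast
    qed (auto simp: monoid_ring_def add_ac)
    show "monoid ?R"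
      by (rule monoidI) (use closed assoc unit in \<open>auto simp: monoid_ring_def split: if_splits\<close>)
  qed (use monoid_ring_distrib in \<open>auto simp: monoid_ring_def\<close>)
qed


section \<open>Tensor products of rings over the integers\<close>

text \<open>
  The ring \<open>A \<otimes> B\<close> is the free abelian group on \<open>A \<times> B\<close>, made into a ring by
  \<open>(a, b) (a', b') = (a a', b b')\<close>, modulo biadditivity. The subgroup spanned by the
  biadditivity relations is already an ideal, because multiplying a relation by a basis element
  gives a relation. No sign appears in the multiplication: the definition is only used when one
  of the two factors is purely even.
\<close>

definition tensor_rels ::
  "('a, 'c) ring_scheme \<Rightarrow> ('b, 'd) ring_scheme \<Rightarrow> ('a \<times> 'b \<Rightarrow>\<^sub>0 int) set" where
  "tensor_rels A B =
     {Poly_Mapping.single (a \<oplus>\<^bsub>A\<^esub> a', b) 1 - Poly_Mapping.single (a, b) 1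
        - Poly_Mapping.single (a', b) 1 | a a' b.
        a \<in> carrier A \<and> a' \<in> carrier A \<and> b \<in> carrier B} \<union>
     {Poly_Mapping.single (a, b \<oplus>\<^bsub>B\<^esub> b') 1 - Poly_Mapping.single (a, b) 1
        - Poly_Mapping.single (a, b') 1 | a b b'.
        a \<in> carrier A \<and> b \<in> carrier B \<and> b' \<in> carrier B}"

definition tensor_ideal ::
  "('a, 'c) ring_scheme \<Rightarrow> ('b, 'd) ring_scheme \<Rightarrow> ('a \<times> 'b \<Rightarrow>\<^sub>0 int) set" where
  "tensor_ideal A B = Idl\<^bsub>monoid_ring (A \<times>\<times> B)\<^esub> (tensor_rels A B)"

definition tensor_ring ::
  "('a, 'c) ring_scheme \<Rightarrow> ('b, 'd) ring_scheme \<Rightarrow> ('a \<times> 'b \<Rightarrow>\<^sub>0 int) set ring" where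
  "tensor_ring A B = monoid_ring (A \<times>\<times> B) Quot tensor_ideal A B"

definition pure_tensor ::
  "('a, 'c) ring_scheme \<Rightarrow> ('b, 'd) ring_scheme \<Rightarrow> 'a \<Rightarrow> 'b \<Rightarrow> ('a \<times> 'b \<Rightarrow>\<^sub>0 int) set" where
  "pure_tensor A B a b =
     tensor_ideal A B +>\<^bsub>monoid_ring (A \<times>\<times> B)\<^esub> Poly_Mapping.single (a, b) 1"


section \<open>The general linear Lie superalgebra over the rationals\<close>

text \<open>
  Library matrices are indexed from \<open>0\<close>, whereas the matrix units \<open>e\<^sub>i\<^sub>j\<close> below are indexed by
  \<open>1 \<le> i, j \<le> m + n\<close>.
\<close>

definition gl :: "nat \<Rightarrow> nat \<Rightarrow> rat mat set" where
  "gl m n = carrier_mat (m + n) (m + n)"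

text \<open>The homogeneous component of parity \<open>d \<in> {0, 1}\<close>.\<close>

definition gl_part :: "nat \<Rightarrow> nat \<Rightarrow> nat \<Rightarrow> rat mat set" where
  "gl_part m n d = {A \<in> gl m n. \<forall>i<m + n. \<forall>j<m + n.
     A $$ (i, j) \<noteq> 0 \<longrightarrow> d = (if (i < m) = (j < m) then 0 else 1)}"

text \<open>The superbracket of homogeneous elements of parities \<open>d\<close> and \<open>d'\<close>.\<close>

definition superbracket :: "nat \<Rightarrow> nat \<Rightarrow> rat mat \<Rightarrow> rat mat \<Rightarrow> rat mat" where
  "superbracket d d' A B = A * B - (-1) ^ (d * d') \<cdot>\<^sub>m (B * A)"

definition mat_unit :: "nat \<Rightarrow> nat \<Rightarrow> nat \<Rightarrow> nat \<Rightarrow> rat mat" where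
  "mat_unit m n i j = mat (m + n) (m + n) (\<lambda>(k, l). if Suc k = i \<and> Suc l = j then 1 else 0)"

definition unit_odd :: "nat \<Rightarrow> nat \<Rightarrow> nat \<Rightarrow> bool" where
  "unit_odd m i j \<longleftrightarrow> (i \<le> m) \<noteq> (j \<le> m)"


section \<open>The universal enveloping superalgebra\<close>

text \<open>
  The tensor algebra of \<open>gl m n\<close> is obtained as the free associative algebra on the set
  \<open>gl m n\<close> modulo linearity; the first two families of relations below express linearity, the
  third one identifies supercommutators with superbrackets.
\<close>

definition word_monoid :: "'a set \<Rightarrow> 'a list monoid" where
  "word_monoid S = \<lparr>carrier = {w. set w \<subseteq> S}, monoid.mult = append, one = []\<rparr>"

definition free_gl :: "nat \<Rightarrow> nat \<Rightarrow> (rat mat list \<Rightarrow>\<^sub>0 rat) ring" where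
  "free_gl m n = monoid_ring (word_monoid (gl m n))"

definition U_rels :: "nat \<Rightarrow> nat \<Rightarrow> (rat mat list \<Rightarrow>\<^sub>0 rat) set" where
  "U_rels m n =
     {Poly_Mapping.single [A + B] 1 - Poly_Mapping.single [A] 1 - Poly_Mapping.single [B] 1 | A B.
        A \<in> gl m n \<and> B \<in> gl m n} \<union>
     {Poly_Mapping.single [c \<cdot>\<^sub>m A] 1 - Poly_Mapping.single [A] c | c A. A \<in> gl m n} \<union>
     {Poly_Mapping.single [A, B] 1 - Poly_Mapping.single [B, A] ((-1) ^ (d * d'))
        - Poly_Mapping.single [superbracket d d' A B] 1 | d d' A B.
        d \<in> {0, 1} \<and> d' \<in> {0, 1} \<and> A \<in> gl_part m n d \<and> B \<in> gl_part m n d'}"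

definition U_ideal :: "nat \<Rightarrow> nat \<Rightarrow> (rat mat list \<Rightarrow>\<^sub>0 rat) set" where
  "U_ideal m n = Idl\<^bsub>free_gl m n\<^esub> (U_rels m n)"

definition U_gl :: "nat \<Rightarrow> nat \<Rightarrow> (rat mat list \<Rightarrow>\<^sub>0 rat) set ring" where
  "U_gl m n = free_gl m n Quot U_ideal m n"

text \<open>The structure map \<open>\<rat> \<rightarrow> U\<close>; scalar multiplication is multiplication by its values.\<close>

definition U_scalar :: "nat \<Rightarrow> nat \<Rightarrow> rat \<Rightarrow> (rat mat list \<Rightarrow>\<^sub>0 rat) set" where
  "U_scalar m n c = U_ideal m n +>\<^bsub>free_gl m n\<^esub> Poly_Mapping.single [] c"

definition U_unit :: "nat \<Rightarrow> nat \<Rightarrow> nat \<Rightarrow> nat \<Rightarrow> (rat mat list \<Rightarrow>\<^sub>0 rat) set" where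
  "U_unit m n i j = U_ideal m n +>\<^bsub>free_gl m n\<^esub> Poly_Mapping.single [mat_unit m n i j] 1"

definition U_divpow :: "nat \<Rightarrow> nat \<Rightarrow> nat \<Rightarrow> nat \<Rightarrow> nat \<Rightarrow> (rat mat list \<Rightarrow>\<^sub>0 rat) set" where
  "U_divpow m n i j t = U_scalar m n (1 / fact t) \<otimes>\<^bsub>U_gl m n\<^esub> (U_unit m n i j [^]\<^bsub>U_gl m n\<^esub> t)"

primrec ring_ffact :: "('a, 'c) ring_scheme \<Rightarrow> 'a \<Rightarrow> nat \<Rightarrow> 'a" where
  "ring_ffact R x 0 = \<one>\<^bsub>R\<^esub>"
| "ring_ffact R x (Suc k) = ring_ffact R x k \<otimes>\<^bsub>R\<^esub> (x \<ominus>\<^bsub>R\<^esub> [k] \<cdot>\<^bsub>R\<^esub> \<one>\<^bsub>R\<^esub>)"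

definition U_binom :: "nat \<Rightarrow> nat \<Rightarrow> nat \<Rightarrow> nat \<Rightarrow> (rat mat list \<Rightarrow>\<^sub>0 rat) set" where
  "U_binom m n i s = U_scalar m n (1 / fact s) \<otimes>\<^bsub>U_gl m n\<^esub> ring_ffact (U_gl m n) (U_unit m n i i) s"


section \<open>The distribution superalgebra\<close>

definition Dist_Z_gens :: "nat \<Rightarrow> nat \<Rightarrow> (rat mat list \<Rightarrow>\<^sub>0 rat) set set" where
  "Dist_Z_gens m n =
     {U_divpow m n i j t | i j t. i \<in> {1..m + n} \<and> j \<in> {1..m + n} \<and> i \<noteq> j \<and> 1 \<le> t \<and>
        (unit_odd m i j \<longrightarrow> t = 1)} \<union>
     {U_binom m n i s | i s. i \<in> {1..m + n}}"

definition Dist_Z :: "nat \<Rightarrow> nat \<Rightarrow> (rat mat list \<Rightarrow>\<^sub>0 rat) set ring" where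
  "Dist_Z m n = (U_gl m n) \<lparr>carrier := generate_ring (U_gl m n) (Dist_Z_gens m n)\<rparr>"

type_synonym 'k dist = "((rat mat list \<Rightarrow>\<^sub>0 rat) set \<times> 'k \<Rightarrow>\<^sub>0 int) set"

definition Dist :: "nat \<Rightarrow> nat \<Rightarrow> 'k::field itself \<Rightarrow> 'k dist ring" where
  "Dist m n _ = tensor_ring (Dist_Z m n) (ring_of_type_algebra :: 'k ring)"

definition Dist_incl :: "nat \<Rightarrow> nat \<Rightarrow> (rat mat list \<Rightarrow>\<^sub>0 rat) set \<Rightarrow> 'k::field dist" where
  "Dist_incl m n u = pure_tensor (Dist_Z m n) (ring_of_type_algebra :: 'k ring) u 1"

definition divpow :: "nat \<Rightarrow> nat \<Rightarrow> nat \<Rightarrow> nat \<Rightarrow> nat \<Rightarrow> 'k::field dist" where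
  "divpow m n i j t = Dist_incl m n (U_divpow m n i j t)"

definition binom :: "nat \<Rightarrow> nat \<Rightarrow> nat \<Rightarrow> nat \<Rightarrow> 'k::field dist" where
  "binom m n i s = Dist_incl m n (U_binom m n i s)"

text \<open>The element \<open>h\<^sup>(\<^sup>q\<^sup>)\<^sub>t(e\<^sub>i)\<close>.\<close>

definition h_elt :: "nat \<Rightarrow> nat \<Rightarrow> nat \<Rightarrow> nat \<Rightarrow> nat \<Rightarrow> 'k::field dist" where
  "h_elt m n q t i =
     (\<Oplus>\<^bsub>Dist m n TYPE('k)\<^esub> k \<in> {t..q - 1}.
        [((-1) ^ (k - t) * int (k choose t))] \<cdot>\<^bsub>Dist m n TYPE('k)\<^esub> binom m n i k)"

definition residue :: "nat \<Rightarrow> int \<Rightarrow> nat" where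
  "residue q u = nat (u mod int q)"


section \<open>Well-formedness\<close>

text \<open>
  Generated ideals and quotients in the library are meaningful only for rings, so we record that
  all the structures above are rings.
\<close>

lemma tensor_rels_carrier:
  assumes "ring A" "ring B"
  shows "tensor_rels A B \<subseteq> carrier (monoid_ring (A \<times>\<times> B))"
proof -
  interpret A: ring A by fact
  interpret B: ring B by fact
  have d: "f - g \<in> carrier (monoid_ring G)"
    if "f \<in> carrier (monoid_ring G)" "g \<in> carrier (monoid_ring G)"
    for f g :: "'x \<Rightarrow>\<^sub>0 int" and G :: "'x monoid"
    using that keys_diff[of f g] by (auto simp: monoid_ring_def)
  show ?thesis unfolding tensor_rels_def
    by (auto intro!: d) (auto simp: monoid_ring_def)
qed

lemma ring_tensor_ring:
  assumes "ring A" "ring B"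
  shows "ring (tensor_ring A B)"
proof -
  interpret A: ring A by fact
  interpret B: ring B by fact
  interpret M: ring "monoid_ring (A \<times>\<times> B) :: ('a \<times> 'c \<Rightarrow>\<^sub>0 int) ring"
    by (intro ring_monoid_ring DirProd_monoid A.monoid_axioms B.monoid_axioms)
  show ?thesis unfolding tensor_ring_def tensor_ideal_def
    by (intro ideal.quotient_is_ring M.genideal_ideal tensor_rels_carrier assms)
qed

lemma U_rels_carrier: "U_rels m n \<subseteq> carrier (free_gl m n)"
proof -
  have d: "f - g \<in> carrier (monoid_ring G)"
    if "f \<in> carrier (monoid_ring G)" "g \<in> carrier (monoid_ring G)"
    for f g :: "'x \<Rightarrow>\<^sub>0 rat" and G :: "'x monoid"
    using that keys_diff[of f g] by (auto simp: monoid_ring_def)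
  show ?thesis unfolding U_rels_def free_gl_def
    by (auto intro!: d)
       (auto simp: monoid_ring_def word_monoid_def gl_def gl_part_def superbracket_def)
qed

lemma ring_free_gl: "ring (free_gl m n)"
  unfolding free_gl_def by (intro ring_monoid_ring monoidI) (auto simp: word_monoid_def)

lemma ideal_U_ideal: "ideal (U_ideal m n) (free_gl m n)"
  unfolding U_ideal_def by (intro ring.genideal_ideal ring_free_gl U_rels_carrier)

lemma ring_U_gl: "ring (U_gl m n)"
  unfolding U_gl_def by (intro ideal.quotient_is_ring ideal_U_ideal)

lemma U_coset_carrier:
  "x \<in> carrier (free_gl m n) \<Longrightarrow> U_ideal m n +>\<^bsub>free_gl m n\<^esub> x \<in> carrier (U_gl m n)"
  unfolding U_gl_def FactRing_simps by auto

lemma U_scalar_carrier: "U_scalar m n c \<in> carrier (U_gl m n)"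
  unfolding U_scalar_def
  by (rule U_coset_carrier) (auto simp: free_gl_def monoid_ring_def word_monoid_def)

lemma U_unit_carrier: "U_unit m n i j \<in> carrier (U_gl m n)"
  unfolding U_unit_def
  by (rule U_coset_carrier)
     (auto simp: free_gl_def monoid_ring_def word_monoid_def gl_def mat_unit_def)

lemma Dist_Z_gens_carrier: "Dist_Z_gens m n \<subseteq> carrier (U_gl m n)"
proof -
  interpret ring "U_gl m n" by (rule ring_U_gl)
  have "ring_ffact (U_gl m n) (U_unit m n i i) s \<in> carrier (U_gl m n)" for i s
    by (induction s) (auto intro!: U_unit_carrier)
  then show ?thesis
    by (auto simp: Dist_Z_gens_def U_divpow_def U_binom_def
             intro!: U_unit_carrier U_scalar_carrier)
qed

lemma ring_Dist_Z: "ring (Dist_Z m n)"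
  unfolding Dist_Z_def
  by (intro ring.generate_ring_is_ring ring_U_gl Dist_Z_gens_carrier)

lemma ring_Dist: "ring (Dist m n TYPE('k::field))"
  unfolding Dist_def by (intro ring_tensor_ring ring_Dist_Z ring_from_type_algebra)

end

theory Submission
  imports Defs "HOL-Number_Theory.Cong"
begin

text \<open>
  In the enveloping superalgebra, \<open>e\<^sub>i e = e (e\<^sub>i + 1)\<close> and \<open>(e\<^sub>j + 1) e = e e\<^sub>j\<close> for \<open>e = e\<^sub>i\<^sub>j\<close>, so
  moving a polynomial in \<open>e\<^sub>i\<close> or \<open>e\<^sub>j\<close> past \<open>e\<^sup>(\<^sup>t\<^sup>)\<close> translates its argument by \<open>t\<close>. By Pascal's rule,
  translation by 1 turns \<open>\<Sum>\<^sub>l c\<^sub>l (x choose l)\<close> into \<open>\<Sum>\<^sub>l (c\<^sub>l + c\<^sub>l\<^sub>+\<^sub>1) (x choose l)\<close>. On the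
  coefficients of \<open>h\<^sub>a\<close> this operation gives modulo \<open>p\<close> those of \<open>h\<^sub>a\<^sub>-\<^sub>1\<close>, with the index read modulo
  \<open>q\<close>: the top coefficient uses \<open>p dvd (q choose a)\<close> for \<open>0 < a < q\<close>, and \<open>a = 0\<close> uses that \<open>q\<close> is
  odd. The integral identities obtained this way are then reduced modulo \<open>p\<close> in the tensor product.
\<close>

section \<open>Coefficients of the polynomials h\<close>

text \<open>The coefficients of \<open>h_a\<close> extended to all \<open>k\<close>: for
  \<open>k < a\<close> the exponent truncates to 0, but the binomial factor vanishes.\<close>

definition h_coeff :: "nat \<Rightarrow> nat \<Rightarrow> int" where
  "h_coeff a k = (-1) ^ (k - a) * int (k choose a)"

text \<open>The coefficient at \<open>N + 1\<close> is read as 0, because the expansions being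
  translated end at degree \<open>N\<close>.\<close>

definition shift_coeff :: "nat \<Rightarrow> (nat \<Rightarrow> int) \<Rightarrow> nat \<Rightarrow> int" where
  "shift_coeff N c l = c l + (if l < N then c (Suc l) else 0)"

text \<open>Put \<open>q = p^r\<close>. By absorption, \<open>k * C(q,k) = q * C(q-1,k-1)\<close>.
  If \<open>p\<close> did not divide \<open>C(q,k)\<close>, then \<open>q\<close> would divide
  \<open>k\<close>, although \<open>0 < k < q\<close>.\<close>

lemma prime_dvd_choose_prime_power:
  fixes p :: nat
  assumes "prime p" "0 < k" "k < p ^ r"
  shows "p dvd (p ^ r choose k)"
proof (rule ccontr)
  assume "\<not> p dvd (p ^ r choose k)"
  then have co: "coprime (p ^ r) (p ^ r choose k)"
    using assms(1) by (simp add: prime_imp_coprime)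
  have "k * (p ^ r choose k) = p ^ r * (p ^ r - 1 choose (k - 1))"
    using assms by (simp add: times_binomial_minus1_eq)
  then have "p ^ r dvd k * (p ^ r choose k)" by simp
  then have "p ^ r dvd k" using co coprime_dvd_mult_left_iff by blast
  then show False using assms by (auto dest: dvd_imp_le)
qed

text \<open>For \<open>l > a\<close> the left side is
  \<open>(-1)^(l-a) * (C(l+1,a+1) - C(l,a+1))\<close>, so Pascal's rule applies. The cases
  \<open>l < a\<close> and \<open>l = a\<close> are separate because the exponents truncate
  there.\<close>

lemma h_coeff_Suc: "h_coeff (Suc a) l + h_coeff (Suc a) (Suc l) = h_coeff a l"
proof -
  consider "l < a" | "l = a" | d where "l = Suc (a + d)"
    by (metis less_linear less_iff_Suc_add)
  then show ?thesis
    by cases (auto simp: h_coeff_def binomial_eq_0 algebra_simps)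
qed

text \<open>The modulus matters only at \<open>l = q - 1\<close> with \<open>a > 0\<close>; the
  other cases hold as equalities of integers.\<close>

lemma cong_shift_h_coeff:
  assumes "prime p" "odd p" "q = p ^ r" "a < q" "l \<le> q - 1"
  shows "[shift_coeff (q - 1) (h_coeff a) l = h_coeff (residue q (int a - 1)) l] (mod int p)"
proof (cases a)
  case 0
  have q: "q > 0" using assms by linarith
  have "odd q" using assms by simp
  have "(-1) mod int q = int q - 1" using q
    by (simp add: zmod_minus1)
  then have "residue q (int a - 1) = q - 1"
    using 0 q by (simp add: residue_def)
  \<comment> \<open>The coefficients of \<open>h_0\<close> alternate in sign, so neighbours cancel
    below the top, and \<open>(-1)^(q-1) = 1\<close> remains at the top.\<close>
  moreover have "shift_coeff (q - 1) (h_coeff 0) l = h_coeff (q - 1) l"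
  proof (cases "l < q - 1")
    case True
    then show ?thesis by (simp add: shift_coeff_def h_coeff_def)
  next
    case False
    then have "l = q - 1" using assms by simp
    then show ?thesis using \<open>odd q\<close> by (simp add: shift_coeff_def h_coeff_def)
  qed
  ultimately show ?thesis using 0 by simp
next
  case (Suc b)
  then have res: "residue q (int a - 1) = b"
    using assms by (simp add: residue_def)
  show ?thesis
  proof (cases "l < q - 1")
    case True
    then show ?thesis using Suc res by (simp add: shift_coeff_def h_coeff_Suc)
  next
    case False
    then have l: "l = q - 1" "Suc l = q" using assms by auto
    \<comment> \<open>\<open>h_coeff a q\<close> is the coefficient cut off by
      \<open>shift_coeff\<close>, so up to sign it is the whole error at the top index.\<close>
    have "p dvd (q choose a)"
      using prime_dvd_choose_prime_power[of p a r] assms Suc by simp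
    then have "int p dvd h_coeff a q" by (simp add: h_coeff_def)
    moreover have "h_coeff a l - h_coeff b l = - h_coeff a q"
      using h_coeff_Suc[of b l] Suc l by simp
    ultimately show ?thesis using res l by (simp add: shift_coeff_def cong_iff_dvd_diff)
  qed
qed

lemma cong_shift_coeff:
  assumes "\<And>l. l \<le> N \<Longrightarrow> [c l = d l] (mod k)" "l \<le> N"
  shows "[shift_coeff N c l = shift_coeff N d l] (mod k)"
  using assms by (auto simp: shift_coeff_def intro!: cong_add)

lemma residue_less: "q > 0 \<Longrightarrow> residue q u < q"
  by (simp add: residue_def nat_less_iff)

lemma residue_add: "q > 0 \<Longrightarrow> residue q (int (residue q u) + v) = residue q (u + v)"
  by (simp add: residue_def mod_add_left_eq)

lemma residue_of_nat: "a < q \<Longrightarrow> residue q (int a) = a"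
  by (simp add: residue_def)

text \<open>The one-step congruence can be iterated because \<open>shift_coeff\<close> preserves
  congruence on the indices up to \<open>q - 1\<close> and \<open>residue\<close> keeps the new
  index below \<open>q\<close>.\<close>

lemma cong_shift_h_coeff_funpow:
  assumes "prime p" "odd p" "q = p ^ r" "a < q" "l \<le> q - 1"
  shows "[(shift_coeff (q - 1) ^^ t) (h_coeff a) l = h_coeff (residue q (int a - int t)) l] (mod int p)"
  using assms(5)
proof (induction t arbitrary: l)
  case 0
  then show ?case using assms by (simp add: residue_of_nat)
next
  case (Suc t)
  have q: "q > 0" using assms by linarith
  let ?b = "residue q (int a - int t)"
  have "[shift_coeff (q - 1) ((shift_coeff (q - 1) ^^ t) (h_coeff a)) l
      = shift_coeff (q - 1) (h_coeff ?b) l] (mod int p)"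
    by (intro cong_shift_coeff Suc)
  also have "[shift_coeff (q - 1) (h_coeff ?b) l = h_coeff (residue q (int ?b - 1)) l] (mod int p)"
    by (rule cong_shift_h_coeff[OF assms(1-3) residue_less[OF q] Suc.prems])
  also have "residue q (int ?b - 1) = residue q (int a - int (Suc t))"
    using residue_add[OF q, of "int a - int t" "-1"] by (simp add: algebra_simps)
  finally show ?case by simp
qed

section \<open>Integral combinations of divided falling factorials\<close>

text \<open>The element \<open>s l\<close> plays the role of \<open>1 / l!\<close>, so the ring need
  not come with a rational scalar action.\<close>

definition newton_sum ::
  "('a, 'c) ring_scheme \<Rightarrow> (nat \<Rightarrow> 'a) \<Rightarrow> nat \<Rightarrow> (nat \<Rightarrow> int) \<Rightarrow> 'a \<Rightarrow> 'a" where
  "newton_sum R s N c y =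
     (\<Oplus>\<^bsub>R\<^esub>l\<in>{..N}. [c l] \<cdot>\<^bsub>R\<^esub> (s l \<otimes>\<^bsub>R\<^esub> ring_ffact R y l))"

context ring
begin

lemma ring_ffact_closed [simp]: "y \<in> carrier R \<Longrightarrow> ring_ffact R y k \<in> carrier R"
  by (induction k) simp_all

section \<open>Moving falling factorials past an element\<close>

lemma intertwine_minus_nat:
  assumes "y \<in> carrier R" "z \<in> carrier R" "e \<in> carrier R" "y \<otimes> e = e \<otimes> z"
  shows "(y \<ominus> [(k::nat)] \<cdot> \<one>) \<otimes> e = e \<otimes> (z \<ominus> [k] \<cdot> \<one>)"
  using assms by (simp add: minus_eq l_distr r_distr l_minus r_minus add_pow_ldistr add_pow_rdistr)

text \<open>The relation \<open>y e = e z\<close> passes to \<open>y - k\<close> and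
  \<open>z - k\<close>, since multiples of 1 are central, and then to products factor by
  factor.\<close>

lemma ring_ffact_intertwine:
  assumes "y \<in> carrier R" "z \<in> carrier R" "e \<in> carrier R" "y \<otimes> e = e \<otimes> z"
  shows "ring_ffact R y k \<otimes> e = e \<otimes> ring_ffact R z k"
proof (induction k)
  case (Suc k)
  have "ring_ffact R y (Suc k) \<otimes> e = ring_ffact R y k \<otimes> (e \<otimes> (z \<ominus> [k] \<cdot> \<one>))"
    using assms by (simp add: m_assoc intertwine_minus_nat)
  also have "\<dots> = (ring_ffact R y k \<otimes> e) \<otimes> (z \<ominus> [k] \<cdot> \<one>)"
    using assms by (simp add: m_assoc)
  also have "\<dots> = e \<otimes> ring_ffact R z (Suc k)"
    using assms by (simp add: Suc m_assoc)
  finally show ?case .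
qed (use assms in simp)

lemma newton_sum_intertwine:
  assumes "y \<in> carrier R" "z \<in> carrier R" "e \<in> carrier R" "y \<otimes> e = e \<otimes> z"
    and s: "\<And>l. s l \<in> carrier R" "\<And>l. s l \<otimes> e = e \<otimes> s l"
  shows "newton_sum R s N c y \<otimes> e = e \<otimes> newton_sum R s N c z"
proof -
  have "(s l \<otimes> ring_ffact R y l) \<otimes> e = e \<otimes> (s l \<otimes> ring_ffact R z l)" for l
    using assms ring_ffact_intertwine[OF assms(1-4)] by (metis m_assoc ring_ffact_closed)
  then show ?thesis
    using assms
    by (auto simp: newton_sum_def finsum_ldistr finsum_rdistr add_pow_ldistr_int add_pow_rdistr_int
             intro!: finsum_cong')
qed

section \<open>Translation of the argument\<close>

text \<open>The factors on the left are \<open>y + 1, y, ..., y - k + 1\<close>; the first one is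
  moved to the end.\<close>

lemma ring_ffact_plus_one:
  assumes y: "y \<in> carrier R"
  shows "ring_ffact R (y \<oplus> \<one>) (Suc k) = ring_ffact R y k \<otimes> (y \<oplus> \<one>)"
proof (induction k)
  case 0
  then show ?case using y by (simp add: minus_eq)
next
  case (Suc k)
  have c: "[k] \<cdot> \<one> \<in> carrier R" by simp
  have e: "y \<oplus> \<one> \<ominus> [Suc k] \<cdot> \<one> = y \<ominus> [k] \<cdot> \<one>"
    using y c by (simp add: minus_eq minus_add a_ac r_neg r_neg1 r_neg2)
  \<comment> \<open>The ring is noncommutative, so the exchange needs a proof: \<open>y\<close>
    commutes with \<open>y + 1\<close>, hence so does \<open>y - k\<close>.\<close>
  have com: "(y \<oplus> \<one>) \<otimes> (y \<ominus> [k] \<cdot> \<one>) = (y \<ominus> [k] \<cdot> \<one>) \<otimes> (y \<oplus> \<one>)"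
    using intertwine_minus_nat[of y y "y \<oplus> \<one>" k] y by (simp add: l_distr r_distr)
  show ?case
    using y unfolding ring_ffact.simps(2)[of R "y \<oplus> \<one>" "Suc k"] Suc e
    by (simp add: m_assoc com)
qed

text \<open>Pascal's rule for binomials in \<open>y\<close>. The factor \<open>y + 1\<close> is
  split as \<open>(y - k) + (k + 1)\<close>: the first part completes the longer falling factorial,
  and the integer \<open>k + 1\<close> turns \<open>s (Suc k)\<close> into
  \<open>s k\<close>.\<close>

lemma divided_ffact_Pascal:
  assumes y: "y \<in> carrier R"
    and s: "\<And>l. s l \<in> carrier R" "\<And>l. [Suc l] \<cdot> s (Suc l) = s l"
  shows "s (Suc k) \<otimes> ring_ffact R (y \<oplus> \<one>) (Suc k)
    = s (Suc k) \<otimes> ring_ffact R y (Suc k) \<oplus> s k \<otimes> ring_ffact R y k"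
proof -
  have c: "[k] \<cdot> \<one> \<in> carrier R" by simp
  have "y \<oplus> \<one> = (y \<ominus> [k] \<cdot> \<one>) \<oplus> [Suc k] \<cdot> \<one>"
    using y c by (simp add: minus_eq a_ac r_neg r_neg1 r_neg2)
  then have "ring_ffact R (y \<oplus> \<one>) (Suc k) = ring_ffact R y (Suc k) \<oplus> [Suc k] \<cdot> ring_ffact R y k"
    unfolding ring_ffact_plus_one[OF y] using y
    by (simp add: r_distr add_pow_rdistr del: add.nat_pow_Suc)
  moreover have "s (Suc k) \<otimes> ([Suc k] \<cdot> ring_ffact R y k) = s k \<otimes> ring_ffact R y k"
    using y s(1) by (metis add_pow_rdistr add_pow_ldistr s(2) ring_ffact_closed)
  ultimately show ?thesis using y s(1) by (simp add: r_distr del: add.nat_pow_Suc)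
qed

lemma newton_sum_plus_one:
  assumes y: "y \<in> carrier R"
    and s: "\<And>l. s l \<in> carrier R" "\<And>l. [Suc l] \<cdot> s (Suc l) = s l"
  shows "newton_sum R s N c (y \<oplus> \<one>) = newton_sum R s N (shift_coeff N c) y"
proof -
  define B where "B l = s l \<otimes> ring_ffact R y l" for l
  have B [simp]: "B l \<in> carrier R" for l using y s by (simp add: B_def)
  \<comment> \<open>Pascal's rule termwise: the index \<open>l = k + 1\<close> contributes the lower
    binomial \<open>B k\<close>, and \<open>l = 0\<close> contributes none.\<close>
  have "newton_sum R s N c (y \<oplus> \<one>) =
      (\<Oplus>l\<in>{..N}. [c l] \<cdot> B l \<oplus> (case l of 0 \<Rightarrow> \<zero> | Suc k \<Rightarrow> [c l] \<cdot> B k))"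
    unfolding newton_sum_def
  proof (rule finsum_cong')
    fix l
    show "[c l] \<cdot> (s l \<otimes> ring_ffact R (y \<oplus> \<one>) l)
        = [c l] \<cdot> B l \<oplus> (case l of 0 \<Rightarrow> \<zero> | Suc k \<Rightarrow> [c l] \<cdot> B k)"
    proof (cases l)
      case 0
      then show ?thesis using y s by (simp add: B_def)
    next
      case (Suc k)
      then show ?thesis unfolding Suc divided_ffact_Pascal[OF y s] B_def[symmetric]
        by (simp add: add.int_pow_mult_distrib a_comm)
    qed
  qed (auto split: nat.split)
  also have "\<dots> = (\<Oplus>l\<in>{..N}. [c l] \<cdot> B l) \<oplus>
      (\<Oplus>l\<in>{..N}. case l of 0 \<Rightarrow> \<zero> | Suc k \<Rightarrow> [c l] \<cdot> B k)"
    by (rule finsum_addf) (auto split: nat.split)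
  \<comment> \<open>After reindexing by \<open>l = k + 1\<close> the lower terms stop before degree
    \<open>N\<close>; the conditional pads them with a zero term at \<open>N\<close>.\<close>
  also have "(\<Oplus>l\<in>{..N}. case l of 0 \<Rightarrow> \<zero> | Suc k \<Rightarrow> [c l] \<cdot> B k)
      = (\<Oplus>l\<in>{..N}. [(if l < N then c (Suc l) else 0)] \<cdot> B l)"
  proof (cases N)
    case (Suc M)
    have "(\<Oplus>l\<in>{..Suc M}. case l of 0 \<Rightarrow> \<zero> | Suc k \<Rightarrow> [c l] \<cdot> B k)
        = (\<Oplus>l\<in>{..M}. [c (Suc l)] \<cdot> B l)"
      by (subst finsum_Suc2) (auto split: nat.split)
    also have "\<dots> = (\<Oplus>l\<in>{..M}. [(if l < Suc M then c (Suc l) else 0)] \<cdot> B l)"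
      by (rule finsum_cong') auto
    also have "\<dots> = (\<Oplus>l\<in>{..Suc M}. [(if l < Suc M then c (Suc l) else 0)] \<cdot> B l)"
      by (subst finsum_Suc) (auto simp: add_pow_int_ge)
    finally show ?thesis using Suc by simp
  qed (simp add: add_pow_int_ge)
  also have "(\<Oplus>l\<in>{..N}. [c l] \<cdot> B l) \<oplus> \<dots> = newton_sum R s N (shift_coeff N c) y"
    unfolding newton_sum_def B_def[symmetric]
    by (subst finsum_addf[symmetric]) (auto simp: shift_coeff_def add.int_pow_mult intro!: finsum_cong')
  finally show ?thesis .
qed

lemma newton_sum_plus_nat:
  assumes y: "y \<in> carrier R"
    and s: "\<And>l. s l \<in> carrier R" "\<And>l. [Suc l] \<cdot> s (Suc l) = s l"
  shows "newton_sum R s N c (y \<oplus> [(t::nat)] \<cdot> \<one>) = newton_sum R s N ((shift_coeff N ^^ t) c) y"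
  using y
proof (induction t arbitrary: y)
  case (Suc t)
  have "y \<oplus> [Suc t] \<cdot> \<one> = (y \<oplus> \<one>) \<oplus> [t] \<cdot> \<one>"
    using Suc.prems by (simp add: a_ac)
  then show ?case
    using Suc newton_sum_plus_one[of y s N] s by simp
qed simp

section \<open>Moving an element past powers\<close>

lemma intertwine_pow_right:
  assumes "x \<in> carrier R" "e \<in> carrier R" "x \<otimes> e = e \<otimes> (x \<oplus> \<one>)"
  shows "x \<otimes> e [^] (t::nat) = e [^] t \<otimes> (x \<oplus> [t] \<cdot> \<one>)"
proof (induction t)
  case (Suc t)
  have "x \<otimes> e [^] Suc t = e [^] t \<otimes> ((x \<oplus> [t] \<cdot> \<one>) \<otimes> e)"
    using assms Suc by (simp add: m_assoc[symmetric])
  also have "(x \<oplus> [t] \<cdot> \<one>) \<otimes> e = e \<otimes> (x \<oplus> [Suc t] \<cdot> \<one>)"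
    using assms by (simp add: l_distr r_distr add_pow_ldistr add_pow_rdistr a_ac)
  finally show ?case using assms by (simp add: m_assoc)
qed (use assms in simp)

text \<open>The translation is kept on the left, instead of writing \<open>x e = e (x - 1)\<close>,
  so that only upward translations by natural numbers occur.\<close>

lemma intertwine_pow_left:
  assumes "x \<in> carrier R" "e \<in> carrier R" "(x \<oplus> \<one>) \<otimes> e = e \<otimes> x"
  shows "(x \<oplus> [(t::nat)] \<cdot> \<one>) \<otimes> e [^] t = e [^] t \<otimes> x"
proof (induction t)
  case (Suc t)
  have et: "e [^] t \<otimes> e = e \<otimes> e [^] t" using assms by (simp flip: nat_pow_Suc2)
  \<comment> \<open>Passing a single factor \<open>e\<close> lowers \<open>t + 1\<close> to
    \<open>t\<close>, after which the induction hypothesis handles the remaining power.\<close>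
  have "(x \<oplus> [Suc t] \<cdot> \<one>) \<otimes> e = (x \<oplus> \<one>) \<otimes> e \<oplus> [t] \<cdot> e"
    using assms(1,2) by (simp add: l_distr add_pow_ldistr a_ac)
  also have "\<dots> = e \<otimes> (x \<oplus> [t] \<cdot> \<one>)"
    using assms by (simp add: r_distr add_pow_rdistr)
  finally have "(x \<oplus> [Suc t] \<cdot> \<one>) \<otimes> e [^] Suc t = e \<otimes> ((x \<oplus> [t] \<cdot> \<one>) \<otimes> e [^] t)"
    using assms by (simp add: et m_assoc[symmetric])
  also have "\<dots> = e [^] Suc t \<otimes> x"
    using assms Suc by (simp add: et m_assoc[symmetric])
  finally show ?case .
qed (use assms in simp)

lemma intertwine_pow_commute:
  assumes "x \<in> carrier R" "e \<in> carrier R" "x \<otimes> e = e \<otimes> x"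
  shows "x \<otimes> e [^] (t::nat) = e [^] t \<otimes> x"
  using assms by (induction t) (simp_all, metis m_assoc nat_pow_closed)

text \<open>Used with \<open>c = 1 / t!\<close> to pass from powers to divided powers:
  \<open>y c e = c y e = c e z\<close>.\<close>

lemma intertwine_scale:
  assumes "y \<in> carrier R" "z \<in> carrier R" "e \<in> carrier R" "c \<in> carrier R"
    and "y \<otimes> e = e \<otimes> z" "c \<otimes> y = y \<otimes> c"
  shows "y \<otimes> (c \<otimes> e) = (c \<otimes> e) \<otimes> z"
  using assms by (metis m_assoc)

end

section \<open>Equality of cosets in quotients of monoid rings\<close>

lemma monoid_ring_coset_eqI:
  assumes I: "ideal I (monoid_ring G)"
    and f: "f \<in> carrier (monoid_ring G)" and g: "g \<in> carrier (monoid_ring G)" and "f - g \<in> I"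
  shows "I +>\<^bsub>monoid_ring G\<^esub> f = I +>\<^bsub>monoid_ring G\<^esub> g"
proof -
  interpret ideal I "monoid_ring G" by (rule I)
  have "- g \<in> carrier (monoid_ring G)" "- g \<oplus>\<^bsub>monoid_ring G\<^esub> g = \<zero>\<^bsub>monoid_ring G\<^esub>"
    using g by (simp_all add: monoid_ring_def)
  \<comment> \<open>The relations are written with subtraction of finitely supported functions,
    while coset equality uses the additive inverse of the ring record; uniqueness of inverses
    identifies the two.\<close>
  then have "\<ominus>\<^bsub>monoid_ring G\<^esub> g = - g" using g minus_equality by blast
  then have "f \<ominus>\<^bsub>monoid_ring G\<^esub> g = f - g"
    by (simp add: a_minus_def) (simp add: monoid_ring_def)
  then show ?thesis
    using quotient_eq_iff_same_a_r_cos[OF I f g] \<open>f - g \<in> I\<close> by simp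
qed

section \<open>Relations in the enveloping superalgebra\<close>

lemma single_word_carrier:
  "set w \<subseteq> gl m n \<Longrightarrow> Poly_Mapping.single w c \<in> carrier (free_gl m n)"
  by (auto simp: free_gl_def monoid_ring_def word_monoid_def)

lemma free_gl_mult_single:
  "Poly_Mapping.single v a \<otimes>\<^bsub>free_gl m n\<^esub> Poly_Mapping.single w b
    = Poly_Mapping.single (v @ w) (a * b)"
  by (simp add: free_gl_def monoid_ring_mult_single word_monoid_def)

lemma free_gl_simps [simp]:
  "f \<oplus>\<^bsub>free_gl m n\<^esub> g = f + g" "\<zero>\<^bsub>free_gl m n\<^esub> = 0"
  "\<one>\<^bsub>free_gl m n\<^esub> = Poly_Mapping.single [] 1"
  by (simp_all add: free_gl_def monoid_ring_def word_monoid_def)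

lemma U_coset_ring_hom:
  "ring_hom_ring (free_gl m n) (U_gl m n) ((+>\<^bsub>free_gl m n\<^esub>) (U_ideal m n))"
  unfolding U_gl_def by (rule ideal.rcos_ring_hom_ring[OF ideal_U_ideal])

lemma U_coset_eqI:
  assumes "f \<in> carrier (free_gl m n)" "g \<in> carrier (free_gl m n)" "f - g \<in> U_ideal m n"
  shows "U_ideal m n +>\<^bsub>free_gl m n\<^esub> f = U_ideal m n +>\<^bsub>free_gl m n\<^esub> g"
  using assms ideal_U_ideal[of m n] unfolding free_gl_def by (rule_tac monoid_ring_coset_eqI)

lemma U_rels_in_ideal: "f \<in> U_rels m n \<Longrightarrow> f \<in> U_ideal m n"
  using ring.genideal_self[OF ring_free_gl U_rels_carrier] by (auto simp: U_ideal_def)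

section \<open>Rational scalars in the enveloping superalgebra\<close>

lemma U_scalar_mult: "U_scalar m n c \<otimes>\<^bsub>U_gl m n\<^esub> U_scalar m n d = U_scalar m n (c * d)"
proof -
  interpret h: ring_hom_ring "free_gl m n" "U_gl m n" "(+>\<^bsub>free_gl m n\<^esub>) (U_ideal m n)"
    by (rule U_coset_ring_hom)
  show ?thesis
    using single_word_carrier[of "[]" m n]
    by (simp add: U_scalar_def h.hom_mult[symmetric] free_gl_mult_single)
qed

lemma U_scalar_of_nat:
  "U_scalar m n (of_nat k) = [k] \<cdot>\<^bsub>U_gl m n\<^esub> \<one>\<^bsub>U_gl m n\<^esub>"
proof -
  interpret U: ring "U_gl m n" by (rule ring_U_gl)
  interpret h: ring_hom_ring "free_gl m n" "U_gl m n" "(+>\<^bsub>free_gl m n\<^esub>) (U_ideal m n)"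
    by (rule U_coset_ring_hom)
  have c: "Poly_Mapping.single [] c \<in> carrier (free_gl m n)" for c
    using single_word_carrier[of "[]" m n] by simp
  show ?thesis
  proof (induction k)
    case 0
    then show ?case using h.hom_zero by (simp add: U_scalar_def)
  next
    case (Suc k)
    have "U_scalar m n (of_nat (Suc k)) = U_scalar m n (of_nat k) \<oplus>\<^bsub>U_gl m n\<^esub> \<one>\<^bsub>U_gl m n\<^esub>"
      unfolding U_scalar_def using h.hom_add[OF c c, of "of_nat k" 1] h.hom_one
      by (simp add: single_add[symmetric] add.commute)
    then show ?case using Suc by simp
  qed
qed

text \<open>Supplies the condition on \<open>s\<close> in \<open>divided_ffact_Pascal\<close>: the
  integer multiple is a product with a scalar, and
  \<open>(l + 1) / (l + 1)! = 1 / l!\<close>.\<close>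

lemma U_scalar_Suc_divfact:
  "[Suc l] \<cdot>\<^bsub>U_gl m n\<^esub> U_scalar m n (1 / fact (Suc l)) = U_scalar m n (1 / fact l)"
proof -
  interpret U: ring "U_gl m n" by (rule ring_U_gl)
  have "[Suc l] \<cdot>\<^bsub>U_gl m n\<^esub> U_scalar m n (1 / fact (Suc l))
      = U_scalar m n (of_nat (Suc l)) \<otimes>\<^bsub>U_gl m n\<^esub> U_scalar m n (1 / fact (Suc l))"
    unfolding U_scalar_of_nat using U_scalar_carrier
    by (simp add: U.add_pow_ldistr del: U.add.nat_pow_Suc)
  also have "of_nat (Suc l) * (1 / fact (Suc l)) = (1 / fact l :: rat)"
    by (simp add: divide_simps del: of_nat_Suc)
  then have "U_scalar m n (of_nat (Suc l)) \<otimes>\<^bsub>U_gl m n\<^esub> U_scalar m n (1 / fact (Suc l))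
      = U_scalar m n (1 / fact l)"
    unfolding U_scalar_mult by (rule arg_cong)
  finally show ?thesis .
qed

text \<open>Scalars are supported on the empty word, so the two products already agree in the free
  algebra.\<close>

lemma U_scalar_unit_commute:
  "U_scalar m n c \<otimes>\<^bsub>U_gl m n\<^esub> U_unit m n i j = U_unit m n i j \<otimes>\<^bsub>U_gl m n\<^esub> U_scalar m n c"
proof -
  interpret h: ring_hom_ring "free_gl m n" "U_gl m n" "(+>\<^bsub>free_gl m n\<^esub>) (U_ideal m n)"
    by (rule U_coset_ring_hom)
  have "mat_unit m n i j \<in> gl m n" by (simp add: gl_def mat_unit_def)
  then show ?thesis
    using single_word_carrier[of "[]" m n] single_word_carrier[of "[mat_unit m n i j]" m n]
    by (simp add: U_scalar_def U_unit_def h.hom_mult[symmetric] free_gl_mult_single)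
qed

lemma U_binom_conv_newton:
  "newton_sum (U_gl m n) (\<lambda>l. U_scalar m n (1 / fact l)) N c (U_unit m n i i)
    = (\<Oplus>\<^bsub>U_gl m n\<^esub>l\<in>{..N}. [c l] \<cdot>\<^bsub>U_gl m n\<^esub> U_binom m n i l)"
  by (simp add: newton_sum_def U_binom_def)

section \<open>Matrix units and their commutators\<close>

lemma mat_unit_mult:
  assumes "j \<in> {1..m + n}"
  shows "mat_unit m n i j * mat_unit m n k l
    = (if j = k then mat_unit m n i l else 0\<^sub>m (m + n) (m + n))"
proof (rule eq_matI)
  fix a b
  assume "a < dim_row (if j = k then mat_unit m n i l else 0\<^sub>m (m + n) (m + n))"
    "b < dim_col (if j = k then mat_unit m n i l else 0\<^sub>m (m + n) (m + n))"
  then have ab: "a < m + n" "b < m + n" by (auto simp: mat_unit_def split: if_splits)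
  have "(mat_unit m n i j * mat_unit m n k l) $$ (a, b)
      = (\<Sum>c\<in>{0..<m + n}. (if Suc a = i \<and> Suc c = j then 1 else 0)
          * (if Suc c = k \<and> Suc b = l then 1 else 0))"
    using ab by (simp add: mat_unit_def scalar_prod_def)
  \<comment> \<open>Only the inner index \<open>c = j - 1\<close> can contribute, since entries are
    counted from 0 and matrix units from 1; the range of \<open>j\<close> puts this index inside the
    matrix.\<close>
  also have "\<dots> = (\<Sum>c\<in>{j - 1}. (if Suc a = i \<and> Suc c = j then 1 else 0)
          * (if Suc c = k \<and> Suc b = l then 1 else 0))"
    by (rule sum.mono_neutral_right) (use assms in auto)
  finally show "(mat_unit m n i j * mat_unit m n k l) $$ (a, b)
      = (if j = k then mat_unit m n i l else 0\<^sub>m (m + n) (m + n)) $$ (a, b)"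
    using ab assms by (auto simp: mat_unit_def)
qed (auto simp: mat_unit_def)

lemma mat_unit_gl_part:
  "mat_unit m n i j \<in> gl_part m n (if unit_odd m i j then 1 else 0)"
  by (auto simp: gl_part_def gl_def mat_unit_def unit_odd_def split: if_splits)

text \<open>Since \<open>A\<close> is even, the sign \<open>(-1)^(0 * d)\<close> is 1 and the
  superbracket is the ordinary commutator, even for odd \<open>B\<close>.\<close>

lemma U_commutator_even:
  assumes A: "A \<in> gl_part m n 0" and B: "B \<in> gl_part m n d" "d \<in> {0, 1}"
    and C: "A * B = B * A + C" "C \<in> gl m n"
  shows "U_ideal m n +>\<^bsub>free_gl m n\<^esub> Poly_Mapping.single [A, B] 1
    = U_ideal m n +>\<^bsub>free_gl m n\<^esub> (Poly_Mapping.single [B, A] 1 + Poly_Mapping.single [C] 1)"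
proof (rule U_coset_eqI)
  have AB: "A \<in> gl m n" "B \<in> gl m n" using A B by (auto simp: gl_part_def)
  show "Poly_Mapping.single [A, B] 1 \<in> carrier (free_gl m n)"
    using AB by (simp add: single_word_carrier)
  interpret F: ring "free_gl m n" by (rule ring_free_gl)
  show "Poly_Mapping.single [B, A] 1 + Poly_Mapping.single [C] 1 \<in> carrier (free_gl m n)"
    using AB C single_word_carrier[of "[B, A]" m n 1] single_word_carrier[of "[C]" m n 1]
      F.a_closed[of "Poly_Mapping.single [B, A] 1" "Poly_Mapping.single [C] 1"] by simp
  have "superbracket 0 d A B = C"
  proof -
    have carr: "A \<in> carrier_mat (m + n) (m + n)" "B \<in> carrier_mat (m + n) (m + n)"
      "C \<in> carrier_mat (m + n) (m + n)" using AB C by (auto simp: gl_def)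
    show ?thesis unfolding superbracket_def C(1)
      using carr by (intro eq_matI) auto
  qed
  then have "Poly_Mapping.single [A, B] 1 - Poly_Mapping.single [B, A] 1
      - Poly_Mapping.single [C] 1 \<in> U_rels m n"
    using A B unfolding U_rels_def
    by (intro UnI2 CollectI exI[of _ 0] exI[of _ d] exI[of _ A] exI[of _ B]) simp
  then show "Poly_Mapping.single [A, B] 1 - (Poly_Mapping.single [B, A] 1 + Poly_Mapping.single [C] 1)
      \<in> U_ideal m n"
    by (auto simp: diff_diff_eq dest: U_rels_in_ideal)
qed

text \<open>The one-letter word on the zero matrix is nonzero in the free algebra; the scaling
  relation with factor 0 kills it in the quotient.\<close>

lemma U_coset_zero_mat:
  "U_ideal m n +>\<^bsub>free_gl m n\<^esub> Poly_Mapping.single [0\<^sub>m (m + n) (m + n)] 1 = \<zero>\<^bsub>U_gl m n\<^esub>"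
proof -
  interpret h: ring_hom_ring "free_gl m n" "U_gl m n" "(+>\<^bsub>free_gl m n\<^esub>) (U_ideal m n)"
    by (rule U_coset_ring_hom)
  let ?z = "0\<^sub>m (m + n) (m + n) :: rat mat"
  have z: "?z \<in> gl m n" "0 \<cdot>\<^sub>m ?z = ?z" by (auto simp: gl_def)
  then have "Poly_Mapping.single [0 \<cdot>\<^sub>m ?z] 1 - Poly_Mapping.single [?z] 0 \<in> U_rels m n"
    unfolding U_rels_def by blast
  then have "Poly_Mapping.single [?z] 1 - 0 \<in> U_ideal m n"
    using U_rels_in_ideal z by simp
  then have "U_ideal m n +>\<^bsub>free_gl m n\<^esub> Poly_Mapping.single [?z] 1 = U_ideal m n +>\<^bsub>free_gl m n\<^esub> 0"
    using z h.R.zero_closed by (intro U_coset_eqI) (simp_all add: single_word_carrier)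
  then show ?thesis using h.hom_zero by simp
qed

lemma U_commute:
  assumes "A \<in> gl_part m n 0" "B \<in> gl_part m n d" "d \<in> {0, 1}"
    and "A * B = B * A + C" "C \<in> gl m n"
  defines "\<phi> \<equiv> \<lambda>Y. U_ideal m n +>\<^bsub>free_gl m n\<^esub> Poly_Mapping.single [Y] 1"
  shows "\<phi> A \<otimes>\<^bsub>U_gl m n\<^esub> \<phi> B = \<phi> B \<otimes>\<^bsub>U_gl m n\<^esub> \<phi> A \<oplus>\<^bsub>U_gl m n\<^esub> \<phi> C"
proof -
  interpret h: ring_hom_ring "free_gl m n" "U_gl m n" "(+>\<^bsub>free_gl m n\<^esub>) (U_ideal m n)"
    by (rule U_coset_ring_hom)
  have carr: "A \<in> gl m n" "B \<in> gl m n" using assms by (auto simp: gl_part_def)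
  have w: "Poly_Mapping.single [Y] 1 \<in> carrier (free_gl m n)" if "Y \<in> gl m n" for Y
    using that by (simp add: single_word_carrier)
  have "\<phi> A \<otimes>\<^bsub>U_gl m n\<^esub> \<phi> B = U_ideal m n +>\<^bsub>free_gl m n\<^esub> Poly_Mapping.single [A, B] 1"
    using w carr unfolding \<phi>_def by (simp add: h.hom_mult[symmetric] free_gl_mult_single)
  also have "\<dots> = U_ideal m n +>\<^bsub>free_gl m n\<^esub> (Poly_Mapping.single [B, A] 1 + Poly_Mapping.single [C] 1)"
    by (rule U_commutator_even[OF assms(1-5)])
  also have "\<dots> = (U_ideal m n +>\<^bsub>free_gl m n\<^esub> Poly_Mapping.single [B, A] 1) \<oplus>\<^bsub>U_gl m n\<^esub> \<phi> C"
    unfolding \<phi>_def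
    using h.hom_add[of "Poly_Mapping.single [B, A] 1" "Poly_Mapping.single [C] 1"]
      w[OF assms(5)] carr by (simp add: single_word_carrier)
  also have "U_ideal m n +>\<^bsub>free_gl m n\<^esub> Poly_Mapping.single [B, A] 1 = \<phi> B \<otimes>\<^bsub>U_gl m n\<^esub> \<phi> A"
    using w carr unfolding \<phi>_def by (simp add: h.hom_mult[symmetric] free_gl_mult_single)
  finally show ?thesis .
qed

lemma mat_unit_gl: "mat_unit m n i j \<in> gl m n"
  by (simp add: gl_def mat_unit_def)

lemma zero_gl: "0\<^sub>m (m + n) (m + n) \<in> gl m n"
  by (simp add: gl_def)

lemma mat_unit_diag_even: "mat_unit m n i i \<in> gl_part m n 0"
  using mat_unit_gl_part[of m n i i] by (simp add: unit_odd_def)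

text \<open>Both products of the two matrix units vanish, so their commutator is the zero
  matrix.\<close>

lemma U_unit_commute:
  assumes "s \<in> {1..m + n}" "i \<in> {1..m + n}" "j \<in> {1..m + n}" "s \<noteq> i" "s \<noteq> j"
  shows "U_unit m n s s \<otimes>\<^bsub>U_gl m n\<^esub> U_unit m n i j = U_unit m n i j \<otimes>\<^bsub>U_gl m n\<^esub> U_unit m n s s"
proof -
  interpret U: ring "U_gl m n" by (rule ring_U_gl)
  have "U_unit m n s s \<otimes>\<^bsub>U_gl m n\<^esub> U_unit m n i j
      = U_unit m n i j \<otimes>\<^bsub>U_gl m n\<^esub> U_unit m n s s \<oplus>\<^bsub>U_gl m n\<^esub> \<zero>\<^bsub>U_gl m n\<^esub>"
    unfolding U_unit_def U_coset_zero_mat[symmetric]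
    by (rule U_commute[OF mat_unit_diag_even mat_unit_gl_part])
       (use assms in \<open>auto simp: mat_unit_mult zero_gl\<close>)
  then show ?thesis by (simp add: U_unit_carrier)
qed

text \<open>Here \<open>e_ii e_ij = e_ij\<close> and \<open>e_ij e_ii = 0\<close>, so the commutator
  is \<open>e_ij\<close>, which is absorbed as \<open>e_ij * 1\<close>.\<close>

lemma U_unit_row:
  assumes "i \<in> {1..m + n}" "j \<in> {1..m + n}" "i \<noteq> j"
  shows "U_unit m n i i \<otimes>\<^bsub>U_gl m n\<^esub> U_unit m n i j
    = U_unit m n i j \<otimes>\<^bsub>U_gl m n\<^esub> (U_unit m n i i \<oplus>\<^bsub>U_gl m n\<^esub> \<one>\<^bsub>U_gl m n\<^esub>)"
proof -
  interpret U: ring "U_gl m n" by (rule ring_U_gl)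
  have "0\<^sub>m (m + n) (m + n) + mat_unit m n i j = mat_unit m n i j"
    by (rule left_add_zero_mat) (simp add: mat_unit_def)
  then have "U_unit m n i i \<otimes>\<^bsub>U_gl m n\<^esub> U_unit m n i j
      = U_unit m n i j \<otimes>\<^bsub>U_gl m n\<^esub> U_unit m n i i \<oplus>\<^bsub>U_gl m n\<^esub> U_unit m n i j"
    unfolding U_unit_def
    by (intro U_commute[OF mat_unit_diag_even mat_unit_gl_part])
       (use assms in \<open>auto simp: mat_unit_mult mat_unit_gl\<close>)
  then show ?thesis by (simp add: U_unit_carrier U.r_distr)
qed

text \<open>Here \<open>e_jj e_ij = 0\<close> and \<open>e_ij e_jj = e_ij\<close>, so the commutator
  is \<open>- e_ij\<close>; adding \<open>e_ij\<close> on both sides gives the stated form.\<close>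

lemma U_unit_col:
  assumes "i \<in> {1..m + n}" "j \<in> {1..m + n}" "i \<noteq> j"
  shows "(U_unit m n j j \<oplus>\<^bsub>U_gl m n\<^esub> \<one>\<^bsub>U_gl m n\<^esub>) \<otimes>\<^bsub>U_gl m n\<^esub> U_unit m n i j
    = U_unit m n i j \<otimes>\<^bsub>U_gl m n\<^esub> U_unit m n j j"
proof -
  interpret U: ring "U_gl m n" by (rule ring_U_gl)
  interpret h: ring_hom_ring "free_gl m n" "U_gl m n" "(+>\<^bsub>free_gl m n\<^esub>) (U_ideal m n)"
    by (rule U_coset_ring_hom)
  let ?e = "mat_unit m n i j"
  let ?f = "\<lambda>Y. U_ideal m n +>\<^bsub>free_gl m n\<^esub> Poly_Mapping.single [Y] (1::rat)"
  have e: "- ?e \<in> gl m n" "?e \<in> gl m n" by (simp_all add: gl_def mat_unit_def)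
  have "U_unit m n j j \<otimes>\<^bsub>U_gl m n\<^esub> U_unit m n i j
      = U_unit m n i j \<otimes>\<^bsub>U_gl m n\<^esub> U_unit m n j j \<oplus>\<^bsub>U_gl m n\<^esub> ?f (- ?e)"
    unfolding U_unit_def
  proof (rule U_commute[OF mat_unit_diag_even mat_unit_gl_part])
    show "mat_unit m n j j * mat_unit m n i j = mat_unit m n i j * mat_unit m n j j + - mat_unit m n i j"
      using assms by (simp add: mat_unit_mult) (auto simp: mat_unit_def)
  qed (use e in auto)
  \<comment> \<open>The word on the matrix \<open>- e_ij\<close> is not the negative of the word on
    \<open>e_ij\<close>; the additivity relation for \<open>- e_ij + e_ij = 0\<close> identifies
    their classes.\<close>
  moreover have "?f (- ?e) \<oplus>\<^bsub>U_gl m n\<^esub> U_unit m n i j = \<zero>\<^bsub>U_gl m n\<^esub>"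
  proof -
    have s: "Poly_Mapping.single [Y] 1 \<in> carrier (free_gl m n)" if "Y \<in> gl m n" for Y
      using that by (simp add: single_word_carrier)
    have z: "- ?e + ?e = 0\<^sub>m (m + n) (m + n)" by (rule eq_matI) (auto simp: mat_unit_def)
    have "Poly_Mapping.single [- ?e + ?e] 1 - Poly_Mapping.single [- ?e] 1
        - Poly_Mapping.single [?e] 1 \<in> U_rels m n"
      using e unfolding U_rels_def by blast
    then have "Poly_Mapping.single [- ?e + ?e] 1 - (Poly_Mapping.single [- ?e] 1
        + Poly_Mapping.single [?e] 1) \<in> U_ideal m n"
      by (auto simp: diff_diff_eq dest: U_rels_in_ideal)
    then have "?f (- ?e + ?e) = U_ideal m n +>\<^bsub>free_gl m n\<^esub>
        (Poly_Mapping.single [- ?e] 1 + Poly_Mapping.single [?e] 1)"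
      using h.R.a_closed[OF s[OF e(1)] s[OF e(2)]] s zero_gl
      by (intro U_coset_eqI) (simp_all add: z)
    then show ?thesis
      using h.hom_add[OF s[OF e(1)] s[OF e(2)]] U_coset_zero_mat[of m n]
      unfolding z U_unit_def by simp
  qed
  moreover have "?f (- ?e) \<in> carrier (U_gl m n)"
    using e by (intro U_coset_carrier single_word_carrier) simp
  ultimately show ?thesis
    by (simp add: U_unit_carrier U.l_distr U.a_assoc)
qed

section \<open>Pure tensors\<close>

locale tensor_rings = A: ring A + B: ring B
  for A :: "('a, 'c) ring_scheme" and B :: "('b, 'd) ring_scheme"
begin

abbreviation "M \<equiv> monoid_ring (A \<times>\<times> B) :: ('a \<times> 'b \<Rightarrow>\<^sub>0 int) ring"

sublocale M: ring M
  by (intro ring_monoid_ring DirProd_monoid A.monoid_axioms B.monoid_axioms)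

sublocale T: ring "tensor_ring A B"
  by (rule ring_tensor_ring) unfold_locales

lemma ideal_tensor_ideal: "ideal (tensor_ideal A B) M"
  unfolding tensor_ideal_def
  by (intro M.genideal_ideal tensor_rels_carrier A.ring_axioms B.ring_axioms)

sublocale coset: ring_hom_ring M "tensor_ring A B" "(+>\<^bsub>M\<^esub>) (tensor_ideal A B)"
  unfolding tensor_ring_def by (rule ideal.rcos_ring_hom_ring[OF ideal_tensor_ideal])

lemma single_carrier:
  "a \<in> carrier A \<Longrightarrow> b \<in> carrier B \<Longrightarrow> Poly_Mapping.single (a, b) 1 \<in> carrier M"
  by (auto simp: monoid_ring_def)

lemma pure_tensor_closed:
  "a \<in> carrier A \<Longrightarrow> b \<in> carrier B \<Longrightarrow> pure_tensor A B a b \<in> carrier (tensor_ring A B)"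
  unfolding pure_tensor_def by (intro coset.hom_closed single_carrier)

lemma pure_tensor_mult:
  assumes "a \<in> carrier A" "b \<in> carrier B" "a' \<in> carrier A" "b' \<in> carrier B"
  shows "pure_tensor A B a b \<otimes>\<^bsub>tensor_ring A B\<^esub> pure_tensor A B a' b'
    = pure_tensor A B (a \<otimes>\<^bsub>A\<^esub> a') (b \<otimes>\<^bsub>B\<^esub> b')"
  using assms by (simp add: pure_tensor_def coset.hom_mult[symmetric] single_carrier
      monoid_ring_mult_single)

text \<open>Both families of generators of the tensor ideal have this shape, so additivity in either
  argument follows from it.\<close>

lemma pure_tensor_add_aux:
  assumes "a \<in> carrier A" "b \<in> carrier B" "a' \<in> carrier A" "b' \<in> carrier B"
    "a'' \<in> carrier A" "b'' \<in> carrier B"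
    and "Poly_Mapping.single (a, b) 1 - Poly_Mapping.single (a', b') 1
        - Poly_Mapping.single (a'', b'') 1 \<in> tensor_rels A B"
  shows "pure_tensor A B a b = pure_tensor A B a' b' \<oplus>\<^bsub>tensor_ring A B\<^esub> pure_tensor A B a'' b''"
proof -
  have add: "f \<oplus>\<^bsub>M\<^esub> g = f + g" for f g by (simp add: monoid_ring_def)
  note s = single_carrier[OF assms(1,2)] single_carrier[OF assms(3,4)] single_carrier[OF assms(5,6)]
  have "Poly_Mapping.single (a, b) 1 - (Poly_Mapping.single (a', b') 1
        + Poly_Mapping.single (a'', b'') 1) \<in> tensor_ideal A B"
    using assms(7) M.genideal_self[OF tensor_rels_carrier[OF A.ring_axioms B.ring_axioms]]
    by (auto simp: tensor_ideal_def diff_diff_eq)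
  then have "pure_tensor A B a b = tensor_ideal A B +>\<^bsub>M\<^esub>
      (Poly_Mapping.single (a', b') 1 \<oplus>\<^bsub>M\<^esub> Poly_Mapping.single (a'', b'') 1)"
    unfolding pure_tensor_def add
    using M.a_closed[OF s(2,3)] s(1)
    by (intro monoid_ring_coset_eqI ideal_tensor_ideal) (simp_all add: add)
  then show ?thesis using s(2,3) by (simp add: pure_tensor_def)
qed

lemma pure_tensor_add_left:
  assumes "a \<in> carrier A" "a' \<in> carrier A" "b \<in> carrier B"
  shows "pure_tensor A B (a \<oplus>\<^bsub>A\<^esub> a') b
    = pure_tensor A B a b \<oplus>\<^bsub>tensor_ring A B\<^esub> pure_tensor A B a' b"
  by (rule pure_tensor_add_aux) (use assms in \<open>auto simp: tensor_rels_def\<close>)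

lemma pure_tensor_add_right:
  assumes "a \<in> carrier A" "b \<in> carrier B" "b' \<in> carrier B"
  shows "pure_tensor A B a (b \<oplus>\<^bsub>B\<^esub> b')
    = pure_tensor A B a b \<oplus>\<^bsub>tensor_ring A B\<^esub> pure_tensor A B a b'"
  by (rule pure_tensor_add_aux) (use assms in \<open>auto simp: tensor_rels_def\<close>)

lemma pure_tensor_zero_right:
  assumes "a \<in> carrier A"
  shows "pure_tensor A B a \<zero>\<^bsub>B\<^esub> = \<zero>\<^bsub>tensor_ring A B\<^esub>"
  using pure_tensor_add_right[OF assms B.zero_closed B.zero_closed]
    pure_tensor_closed[OF assms B.zero_closed] by simp

text \<open>Extracting multiples from the right factor is what lets the characteristic of the field
  act on pure tensors.\<close>

lemma pure_tensor_nat_right: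
  assumes "a \<in> carrier A" "b \<in> carrier B"
  shows "pure_tensor A B a ([(k::nat)] \<cdot>\<^bsub>B\<^esub> b) = [k] \<cdot>\<^bsub>tensor_ring A B\<^esub> pure_tensor A B a b"
  using assms by (induction k) (simp_all add: pure_tensor_zero_right pure_tensor_add_right)

end

section \<open>Passage to the distribution superalgebra\<close>

lemma ring_of_type_algebra_simps [simp]:
  "carrier ring_of_type_algebra = UNIV" "x \<otimes>\<^bsub>ring_of_type_algebra\<^esub> y = x * y"
  "\<one>\<^bsub>ring_of_type_algebra\<^esub> = 1" "\<zero>\<^bsub>ring_of_type_algebra\<^esub> = 0"
  "x \<oplus>\<^bsub>ring_of_type_algebra\<^esub> y = x + y"
  by (simp_all add: ring_of_type_algebra_def)

lemma ring_of_type_algebra_nat: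
  "[(k::nat)] \<cdot>\<^bsub>ring_of_type_algebra\<^esub> (1::'k::comm_ring_1) = of_nat k"
proof -
  interpret ring "ring_of_type_algebra :: 'k ring" by (rule ring_from_type_algebra)
  show ?thesis
  proof (induction k)
    case (Suc k)
    have "[Suc k] \<cdot>\<^bsub>ring_of_type_algebra\<^esub> (1::'k) = [k] \<cdot>\<^bsub>ring_of_type_algebra\<^esub> (1::'k) + 1"
      by (simp add: add.nat_pow_Suc)
    then show ?case using Suc by simp
  qed simp
qed

locale distribution_algebra =
  fixes m n :: nat and K :: "'k::field itself"
begin

abbreviation "D \<equiv> Dist m n TYPE('k)"
abbreviation "incl \<equiv> Dist_incl m n :: _ \<Rightarrow> 'k dist"
abbreviation "U \<equiv> U_gl m n"

sublocale U: ring U by (rule ring_U_gl)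

sublocale D: ring D by (rule ring_Dist)

sublocale T: tensor_rings "Dist_Z m n" "ring_of_type_algebra :: 'k ring"
  by (intro tensor_rings.intro ring_Dist_Z ring_from_type_algebra)

lemma subring_Dist_Z: "subring (carrier (Dist_Z m n)) U"
  unfolding Dist_Z_def by (simp add: U.generate_ring_is_subring Dist_Z_gens_carrier)

text \<open>\<open>Dist_Z\<close> only replaces the carrier of \<open>U_gl\<close>, so calculations
  stay in \<open>U_gl\<close> and only membership has to be tracked.\<close>

lemma Dist_Z_simps:
  "x \<oplus>\<^bsub>Dist_Z m n\<^esub> y = x \<oplus>\<^bsub>U\<^esub> y" "x \<otimes>\<^bsub>Dist_Z m n\<^esub> y = x \<otimes>\<^bsub>U\<^esub> y" "\<zero>\<^bsub>Dist_Z m n\<^esub> = \<zero>\<^bsub>U\<^esub>"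
  by (simp_all add: Dist_Z_def)

lemmas Dist_Z_zero_closed = subringE(2)[OF subring_Dist_Z]

lemma Dist_Z_in_U: "u \<in> carrier (Dist_Z m n) \<Longrightarrow> u \<in> carrier U"
  using subringE(1)[OF subring_Dist_Z] by blast

section \<open>Compatibility of \<open>u\<close> maps to \<open>u\<close> tensor 1 with the ring
  operations\<close>

lemma incl_closed: "u \<in> carrier (Dist_Z m n) \<Longrightarrow> incl u \<in> carrier D"
  unfolding Dist_incl_def Dist_def by (rule T.pure_tensor_closed) simp_all

lemma incl_add:
  assumes "u \<in> carrier (Dist_Z m n)" "v \<in> carrier (Dist_Z m n)"
  shows "incl (u \<oplus>\<^bsub>U\<^esub> v) = incl u \<oplus>\<^bsub>D\<^esub> incl v"
  using T.pure_tensor_add_left[OF assms, of 1] by (simp add: Dist_incl_def Dist_def Dist_Z_simps)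

lemma incl_mult:
  assumes "u \<in> carrier (Dist_Z m n)" "v \<in> carrier (Dist_Z m n)"
  shows "incl (u \<otimes>\<^bsub>U\<^esub> v) = incl u \<otimes>\<^bsub>D\<^esub> incl v"
  using T.pure_tensor_mult[OF assms(1) _ assms(2), of 1 1]
  by (simp add: Dist_incl_def Dist_def Dist_Z_simps)

lemma incl_zero: "incl \<zero>\<^bsub>U\<^esub> = \<zero>\<^bsub>D\<^esub>"
  using incl_add[OF Dist_Z_zero_closed Dist_Z_zero_closed] incl_closed[OF Dist_Z_zero_closed] by simp

lemma incl_a_inv:
  assumes u: "u \<in> carrier (Dist_Z m n)"
  shows "incl (\<ominus>\<^bsub>U\<^esub> u) = \<ominus>\<^bsub>D\<^esub> incl u"
proof -
  have v: "\<ominus>\<^bsub>U\<^esub> u \<in> carrier (Dist_Z m n)" using u subringE(5)[OF subring_Dist_Z] by blast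
  have "incl (\<ominus>\<^bsub>U\<^esub> u) \<oplus>\<^bsub>D\<^esub> incl u = \<zero>\<^bsub>D\<^esub>"
    using incl_add[OF v u] u by (simp add: U.l_neg Dist_Z_in_U incl_zero)
  then show ?thesis using D.minus_equality incl_closed u v by metis
qed

lemma nat_multiple_closed:
  "u \<in> carrier (Dist_Z m n) \<Longrightarrow> [(k::nat)] \<cdot>\<^bsub>U\<^esub> u \<in> carrier (Dist_Z m n)"
  by (induction k) (auto simp: subringE(2,7)[OF subring_Dist_Z])

lemma incl_nat_multiple:
  assumes "u \<in> carrier (Dist_Z m n)"
  shows "incl ([(k::nat)] \<cdot>\<^bsub>U\<^esub> u) = [k] \<cdot>\<^bsub>D\<^esub> incl u"
  using assms by (induction k) (auto simp: incl_zero incl_add nat_multiple_closed)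

lemma int_multiple_closed:
  assumes "u \<in> carrier (Dist_Z m n)"
  shows "[(c::int)] \<cdot>\<^bsub>U\<^esub> u \<in> carrier (Dist_Z m n)"
  using assms by (cases "c < 0")
    (auto simp: add_pow_int_lt add_pow_int_ge nat_multiple_closed subringE(5)[OF subring_Dist_Z])

lemma incl_int_multiple:
  assumes "u \<in> carrier (Dist_Z m n)"
  shows "incl ([(c::int)] \<cdot>\<^bsub>U\<^esub> u) = [c] \<cdot>\<^bsub>D\<^esub> incl u"
  using assms by (cases "c < 0")
    (auto simp: add_pow_int_lt add_pow_int_ge incl_nat_multiple incl_a_inv nat_multiple_closed)

lemma finsum_Dist_Z_closed:
  assumes "finite S" "\<And>x. x \<in> S \<Longrightarrow> f x \<in> carrier (Dist_Z m n)"
  shows "(\<Oplus>\<^bsub>U\<^esub>x\<in>S. f x) \<in> carrier (Dist_Z m n)"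
  using assms
proof (induction S rule: finite_induct)
  case (insert x S)
  then have "f \<in> S \<rightarrow> carrier U" "f x \<in> carrier U" using Dist_Z_in_U by auto
  then show ?case using insert by (simp add: U.finsum_insert subringE(7)[OF subring_Dist_Z])
qed (simp add: subringE(2)[OF subring_Dist_Z])

lemma incl_finsum:
  assumes "finite S" "\<And>x. x \<in> S \<Longrightarrow> f x \<in> carrier (Dist_Z m n)"
  shows "incl (\<Oplus>\<^bsub>U\<^esub>x\<in>S. f x) = (\<Oplus>\<^bsub>D\<^esub>x\<in>S. incl (f x))"
  using assms
proof (induction S rule: finite_induct)
  case (insert x S)
  then have "f \<in> S \<rightarrow> carrier U" "f x \<in> carrier U"
    "(\<lambda>x. incl (f x)) \<in> S \<rightarrow> carrier D" "incl (f x) \<in> carrier D"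
    using Dist_Z_in_U incl_closed by auto
  then show ?case using insert
    by (simp add: U.finsum_insert D.finsum_insert incl_add finsum_Dist_Z_closed)
qed (simp add: incl_zero)

text \<open>With \<open>p\<close> the characteristic,
  \<open>p (u tensor 1) = u tensor p = u tensor 0 = 0\<close>.\<close>

lemma CHAR_multiple_incl:
  assumes "u \<in> carrier (Dist_Z m n)"
  shows "[(CHAR('k))] \<cdot>\<^bsub>D\<^esub> incl u = \<zero>\<^bsub>D\<^esub>"
  using T.pure_tensor_nat_right[OF assms, of 1 "CHAR('k)"] T.pure_tensor_zero_right[OF assms]
  by (simp add: Dist_incl_def Dist_def ring_of_type_algebra_nat)

text \<open>Here congruences between integral coefficients become equalities in
  \<open>Dist\<close>.\<close>

lemma int_multiple_incl_cong:
  assumes u: "u \<in> carrier (Dist_Z m n)" and "[c = d] (mod int CHAR('k))"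
  shows "[c] \<cdot>\<^bsub>D\<^esub> incl u = [d] \<cdot>\<^bsub>D\<^esub> incl u"
proof -
  obtain w where "c = d + int CHAR('k) * w"
    using assms(2) by (metis cong_iff_lin cong_sym)
  moreover have "[(int CHAR('k) * w)] \<cdot>\<^bsub>D\<^esub> incl u = \<zero>\<^bsub>D\<^esub>"
    using D.add.int_pow_pow[of "incl u" w "int CHAR('k)"] CHAR_multiple_incl[OF u] incl_closed[OF u]
    by (simp add: add_pow_int_ge)
  ultimately show ?thesis using incl_closed[OF u] by (simp add: D.add.int_pow_mult)
qed

section \<open>Integral combinations of binomials and their passage past divided powers\<close>

lemma U_binom_Dist_Z: "i \<in> {1..m + n} \<Longrightarrow> U_binom m n i k \<in> carrier (Dist_Z m n)"
  unfolding Dist_Z_def by (auto simp: Dist_Z_gens_def intro!: generate_ring.incl)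

lemma U_divpow_Dist_Z:
  assumes "i \<in> {1..m + n}" "j \<in> {1..m + n}" "i \<noteq> j" "1 \<le> t" "unit_odd m i j \<longrightarrow> t = 1"
  shows "U_divpow m n i j t \<in> carrier (Dist_Z m n)"
  unfolding Dist_Z_def using assms
  by (auto simp: Dist_Z_gens_def intro!: generate_ring.incl)

text \<open>Written as a Newton sum rather than as a sum of \<open>U_binom\<close>, so that the
  results on translated arguments apply directly.\<close>

definition binom_sum :: "nat \<Rightarrow> (nat \<Rightarrow> int) \<Rightarrow> nat \<Rightarrow> (rat mat list \<Rightarrow>\<^sub>0 rat) set" where
  "binom_sum N c i = newton_sum U (\<lambda>l. U_scalar m n (1 / fact l)) N c (U_unit m n i i)"

lemma binom_sum_Dist_Z: "i \<in> {1..m + n} \<Longrightarrow> binom_sum N c i \<in> carrier (Dist_Z m n)"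
  unfolding binom_sum_def U_binom_conv_newton
  by (intro finsum_Dist_Z_closed int_multiple_closed U_binom_Dist_Z) simp_all

lemma incl_binom_sum:
  assumes "i \<in> {1..m + n}"
  shows "incl (binom_sum N c i) = (\<Oplus>\<^bsub>D\<^esub>l\<in>{..N}. [c l] \<cdot>\<^bsub>D\<^esub> binom m n i l)"
  unfolding binom_sum_def U_binom_conv_newton binom_def
  by (simp add: incl_finsum incl_int_multiple int_multiple_closed U_binom_Dist_Z[OF assms])

lemma binom_closed: "i \<in> {1..m + n} \<Longrightarrow> binom m n i l \<in> carrier D"
  unfolding binom_def by (intro incl_closed U_binom_Dist_Z)

lemma incl_binom_sum_cong:
  assumes "i \<in> {1..m + n}" "\<And>l. l \<le> N \<Longrightarrow> [c l = d l] (mod int CHAR('k))"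
  shows "incl (binom_sum N c i) = incl (binom_sum N d i)"
  unfolding incl_binom_sum[OF assms(1)]
proof (rule D.finsum_cong')
  fix l assume "l \<in> {..N}"
  then show "[c l] \<cdot>\<^bsub>D\<^esub> binom m n i l = [d l] \<cdot>\<^bsub>D\<^esub> binom m n i l"
    unfolding binom_def using assms by (intro int_multiple_incl_cong U_binom_Dist_Z) auto
qed (use binom_closed[OF assms(1)] in auto)

lemma h_elt_eq_incl:
  assumes "i \<in> {1..m + n}"
  shows "h_elt m n q a i = incl (binom_sum (q - 1) (h_coeff a) i)"
  unfolding incl_binom_sum[OF assms] h_elt_def h_coeff_def[symmetric]
  \<comment> \<open>The sum defining \<open>h_elt\<close> starts at \<open>a\<close>; it extends
    down to 0 because the added coefficients vanish.\<close>
  by (rule D.add.finprod_mono_neutral_cong_left)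
     (use binom_closed[OF assms] in \<open>auto simp: h_coeff_def binomial_eq_0 add_pow_int_ge\<close>)

text \<open>The arguments \<open>x\<close> and \<open>z\<close> are left general so that all three
  relations are instances; \<open>scal\<close> lets the factor \<open>1 / t!\<close> of the divided
  power move past \<open>x\<close>.\<close>

lemma binom_sum_divpow:
  fixes N :: nat and c :: "nat \<Rightarrow> int"
  assumes "x \<in> carrier U" "z \<in> carrier U"
    and scal: "\<And>d. U_scalar m n d \<otimes>\<^bsub>U\<^esub> x = x \<otimes>\<^bsub>U\<^esub> U_scalar m n d"
    and int: "x \<otimes>\<^bsub>U\<^esub> U_unit m n i j [^]\<^bsub>U\<^esub> t = U_unit m n i j [^]\<^bsub>U\<^esub> t \<otimes>\<^bsub>U\<^esub> z"
  defines "F \<equiv> newton_sum U (\<lambda>l. U_scalar m n (1 / fact l)) N c"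
  shows "F x \<otimes>\<^bsub>U\<^esub> U_divpow m n i j t = U_divpow m n i j t \<otimes>\<^bsub>U\<^esub> F z"
  unfolding F_def
proof (rule U.newton_sum_intertwine)
  let ?e = "U_unit m n i j [^]\<^bsub>U\<^esub> t"
  have e: "?e \<in> carrier U" by (simp add: U_unit_carrier)
  show "U_divpow m n i j t \<in> carrier U"
    by (simp add: U_divpow_def U_unit_carrier U_scalar_carrier)
  show "x \<otimes>\<^bsub>U\<^esub> U_divpow m n i j t = U_divpow m n i j t \<otimes>\<^bsub>U\<^esub> z"
    unfolding U_divpow_def by (rule U.intertwine_scale) (use assms e U_scalar_carrier in auto)
  fix l
  have "U_scalar m n (1 / fact l) \<otimes>\<^bsub>U\<^esub> ?e = ?e \<otimes>\<^bsub>U\<^esub> U_scalar m n (1 / fact l)"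
    by (intro U.intertwine_pow_commute U_scalar_carrier U_unit_carrier U_scalar_unit_commute)
  then show "U_scalar m n (1 / fact l) \<otimes>\<^bsub>U\<^esub> U_divpow m n i j t
      = U_divpow m n i j t \<otimes>\<^bsub>U\<^esub> U_scalar m n (1 / fact l)"
    unfolding U_divpow_def
    by (intro U.intertwine_scale e U_scalar_carrier) (simp_all add: U_scalar_mult mult.commute)
qed (use assms U_scalar_carrier in auto)

text \<open>Provides \<open>scal\<close> in the column case, where the translated element stands on
  the left.\<close>

lemma scalar_commute_shift:
  "U_scalar m n c \<otimes>\<^bsub>U\<^esub> (U_unit m n i i \<oplus>\<^bsub>U\<^esub> [(t::nat)] \<cdot>\<^bsub>U\<^esub> \<one>\<^bsub>U\<^esub>)
    = (U_unit m n i i \<oplus>\<^bsub>U\<^esub> [t] \<cdot>\<^bsub>U\<^esub> \<one>\<^bsub>U\<^esub>) \<otimes>\<^bsub>U\<^esub> U_scalar m n c"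
  using U_scalar_carrier[of m n c] U_unit_carrier[of m n i i] U_scalar_unit_commute[of m n c i i]
  by (simp add: U.l_distr U.r_distr U.add_pow_ldistr U.add_pow_rdistr)

lemma newton_sum_shift:
  "newton_sum U (\<lambda>l. U_scalar m n (1 / fact l)) N c (U_unit m n i i \<oplus>\<^bsub>U\<^esub> [(t::nat)] \<cdot>\<^bsub>U\<^esub> \<one>\<^bsub>U\<^esub>)
    = binom_sum N ((shift_coeff N ^^ t) c) i"
  unfolding binom_sum_def
  by (rule U.newton_sum_plus_nat) (rule U_unit_carrier U_scalar_carrier U_scalar_Suc_divfact)+

lemma binom_sum_divpow_commute:
  assumes "s \<in> {1..m + n}" "i \<in> {1..m + n}" "j \<in> {1..m + n}" "s \<noteq> i" "s \<noteq> j"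
  shows "binom_sum N c s \<otimes>\<^bsub>U\<^esub> U_divpow m n i j t = U_divpow m n i j t \<otimes>\<^bsub>U\<^esub> binom_sum N c s"
  unfolding binom_sum_def
  by (intro binom_sum_divpow U_unit_carrier U_scalar_unit_commute U.intertwine_pow_commute
        U_unit_commute assms)

lemma binom_sum_divpow_row:
  assumes "i \<in> {1..m + n}" "j \<in> {1..m + n}" "i \<noteq> j"
  shows "binom_sum N c i \<otimes>\<^bsub>U\<^esub> U_divpow m n i j t
    = U_divpow m n i j t \<otimes>\<^bsub>U\<^esub> binom_sum N ((shift_coeff N ^^ t) c) i"
  unfolding newton_sum_shift[symmetric] binom_sum_def[of N c]
  by (intro binom_sum_divpow U_unit_carrier U_scalar_unit_commute U.intertwine_pow_right
        U_unit_row assms U.a_closed U.add.nat_pow_closed U.one_closed)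

text \<open>Since \<open>e_j\<close> is translated on the left, it is the left-hand coefficients
  that get shifted here.\<close>

lemma binom_sum_divpow_col:
  assumes "i \<in> {1..m + n}" "j \<in> {1..m + n}" "i \<noteq> j"
  shows "binom_sum N ((shift_coeff N ^^ t) c) j \<otimes>\<^bsub>U\<^esub> U_divpow m n i j t
    = U_divpow m n i j t \<otimes>\<^bsub>U\<^esub> binom_sum N c j"
  unfolding newton_sum_shift[symmetric] binom_sum_def[of N c]
  by (intro binom_sum_divpow U_unit_carrier scalar_commute_shift U.intertwine_pow_left
        U_unit_col assms U.a_closed U.add.nat_pow_closed U.one_closed)

end

theorem proposition12p1:
  fixes m n p r q a i j t :: nat
  assumes "CHAR('k::field) = p" and "p > 2"
    and "q = p ^ r"
    and "a \<le> q - 1"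
    and "i \<in> {1..m + n}" and "j \<in> {1..m + n}" and "i \<noteq> j"
    and "1 \<le> t" and "t < q" and "unit_odd m i j \<longrightarrow> t = 1"
  shows "(\<forall>s\<in>{1..m + n}. s \<noteq> i \<and> s \<noteq> j \<longrightarrow>
            h_elt m n q a s \<otimes>\<^bsub>Dist m n TYPE('k)\<^esub> divpow m n i j t
              = divpow m n i j t \<otimes>\<^bsub>Dist m n TYPE('k)\<^esub> h_elt m n q a s) \<and>
         h_elt m n q a i \<otimes>\<^bsub>Dist m n TYPE('k)\<^esub> divpow m n i j t
           = divpow m n i j t \<otimes>\<^bsub>Dist m n TYPE('k)\<^esub> h_elt m n q (residue q (int a - int t)) i \<and>
         h_elt m n q a j \<otimes>\<^bsub>Dist m n TYPE('k)\<^esub> divpow m n i j t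
           = divpow m n i j t \<otimes>\<^bsub>Dist m n TYPE('k)\<^esub> h_elt m n q (residue q (int a + int t)) j"
proof -
  interpret distribution_algebra m n "TYPE('k)" .
  \<comment> \<open>The characteristic of a field is prime once it is positive; being above 2, it is
    also odd.\<close>
  have "prime p" using prime_CHAR_semidom[where 'a = 'k] assms(1,2) by simp
  then have p: "prime p" "odd p" using assms(2) by (simp_all add: prime_odd_nat)
  have q: "q > 0" "a < q" using assms by auto
  let ?E = "U_divpow m n i j t"
  note E = U_divpow_Dist_Z[OF assms(5-8,10)]
  \<comment> \<open>The congruences for the shifted coefficients of \<open>h_b\<close> become an
    equality in \<open>Dist\<close>.\<close>
  have shift: "incl (binom_sum (q - 1) ((shift_coeff (q - 1) ^^ t) (h_coeff b)) s)
      = h_elt m n q (residue q (int b - int t)) s" if "b < q" "s \<in> {1..m + n}" for b s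
    unfolding h_elt_eq_incl[OF that(2)]
    by (rule incl_binom_sum_cong[OF that(2)])
       (use cong_shift_h_coeff_funpow[OF p assms(3) that(1)] assms(1) in simp)
  have "h_elt m n q a s \<otimes>\<^bsub>D\<^esub> divpow m n i j t = divpow m n i j t \<otimes>\<^bsub>D\<^esub> h_elt m n q a s"
    if s: "s \<in> {1..m + n}" "s \<noteq> i" "s \<noteq> j" for s
    using binom_sum_divpow_commute[OF s(1) assms(5,6) s(2,3)]
    by (simp add: h_elt_eq_incl[OF s(1)] divpow_def incl_mult[symmetric] binom_sum_Dist_Z[OF s(1)] E)
  moreover have "h_elt m n q a i \<otimes>\<^bsub>D\<^esub> divpow m n i j t
      = divpow m n i j t \<otimes>\<^bsub>D\<^esub> h_elt m n q (residue q (int a - int t)) i"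
    using binom_sum_divpow_row[OF assms(5-7), of "q - 1" "h_coeff a" t]
    unfolding shift[OF q(2) assms(5), symmetric] h_elt_eq_incl[OF assms(5), of q a] divpow_def
    by (simp add: incl_mult[symmetric] binom_sum_Dist_Z[OF assms(5)] E)
  moreover have "h_elt m n q a j \<otimes>\<^bsub>D\<^esub> divpow m n i j t
      = divpow m n i j t \<otimes>\<^bsub>D\<^esub> h_elt m n q (residue q (int a + int t)) j"
  proof -
    \<comment> \<open>Relation (3) is read backwards: shifting the coefficients of
      \<open>h_b\<close> by \<open>t\<close> lowers the index from \<open>b\<close> to
      \<open>a\<close> modulo \<open>q\<close>, which dictates \<open>b = a + t\<close> modulo
      \<open>q\<close>.\<close>
    let ?b = "residue q (int a + int t)"
    have "residue q (int ?b - int t) = a"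
      using residue_add[OF q(1), of "int a + int t" "- int t"] q by (simp add: residue_of_nat)
    then have a: "incl (binom_sum (q - 1) ((shift_coeff (q - 1) ^^ t) (h_coeff ?b)) j)
        = h_elt m n q a j"
      using shift[OF residue_less[OF q(1)] assms(6), of "int a + int t"] by simp
    show ?thesis
      using binom_sum_divpow_col[OF assms(5-7), of "q - 1" t "h_coeff ?b"]
      unfolding a[symmetric] h_elt_eq_incl[OF assms(6), of q ?b] divpow_def
      by (simp add: incl_mult[symmetric] binom_sum_Dist_Z[OF assms(6)] E)
  qed
  ultimately show ?thesis by blast
qed

end
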